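(* Let $\beta>0$ be fixed. For the rewire-to-random model with relabelling rate $\beta$ started with $\tilde G(0)\sim G(n,\tfrac12)$ and independent i.i.d. $\mathrm{Ber}(\tfrac12)$ opinions, there exists $\varepsilon_*=\varepsilon_*(\beta)>0$ (not depending on $n$) such that $\tau<\tau_*(\varepsilon_* )$ with high probability, i.e. with probability tending to $1$ as $n\to\infty$.
   Context: The model. Let $V$ be a set of $n$ vertices. The state $G(t)$, $t=0,1,2,\dots$, of a discrete time Markov chain is a multigraph on $V$ (multiple edges allowed, no self-loops) with a fixed set of labelled edges, together with an opinion $v(t)\in\{0,1\}$ for each $v\in V$. An edge joining $u$ and $v$ is disagreeing at time $t$ if $u(t)\ne v(t)$. $\tilde G(t)$ denotes the underlying multigraph. Initial condition: $\tilde G(0)$ is the Erdős–Rényi graph $G(n,\frac12)$ and $\{v(0)\}_{v\in V}$ are i.i.d. $\mathrm{Ber}(\frac12)$, independent of the graph. Rewire-to-random transition with relabelling rate $\beta>0$ ($n>\beta$): at each step, choose a uniformly random disagreeing edge $e$, joining say $u$ and $v$, and choose one of its two endpoints uniformly at random as root, say $u$. Independently, with probability $\beta/n$, $u$ adopts the opinion of $v$ and nothing else changes (relabelling step); with probability $1-\beta/n$, opinions do not change, and $e$ is removed from the pair $(u,v)$ and placed at the pair $(u,v')$ with $v'$ uniformly random in $V\setminus\{u\}$ (rewiring step). If there is no disagreeing edge, the chain stays put. $\tau$ is the first time at which there are no disagreeing edges. $N_0(t),N_1(t)$ are the numbers of vertices with opinion $0$, $1$ at time $t$, $N_*(t)=\min\{N_0(t),N_1(t)\}$,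 and $\tau_*(\varepsilon)=\min\{t: N_*(t)\le\varepsilon n\}$ (with $\min\emptyset=\infty$). *)

theory Defs
  imports "HOL-Probability.Probability"
begin

section \<open>Path measure of a discrete-time Markov chain\<close>

definition mc_kernel :: "'s pmf \<Rightarrow> ('s \<Rightarrow> 's pmf) \<Rightarrow> nat \<Rightarrow> (nat \<Rightarrow> 's) \<Rightarrow> 's measure" where
  "mc_kernel \<mu> K t \<omega> = (case t of 0 \<Rightarrow> measure_pmf \<mu> | Suc s \<Rightarrow> measure_pmf (K (\<omega> s)))"

text \<open>
  The law of the whole trajectory, as the Ionescu-Tulcea limit measure. The lemma
  \<open>prob_mc_path_cylinder\<close> below gives its finite-dimensional distributions.
\<close>

definition mc_path :: "'s pmf \<Rightarrow> ('s \<Rightarrow> 's pmf) \<Rightarrow> (nat \<Rightarrow> 's) measure" where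
  "mc_path \<mu> K =
     projective_family.lim UNIV
       (Ionescu_Tulcea.CI (mc_kernel \<mu> K) (\<lambda>_. count_space UNIV)) (\<lambda>_. count_space UNIV)"

lemma Ionescu_Tulcea_mc_kernel: "Ionescu_Tulcea (mc_kernel \<mu> K) (\<lambda>_. count_space UNIV)"
proof (rule Ionescu_Tulcea.intro)
  show "mc_kernel \<mu> K t \<in> PiM {0..<t} (\<lambda>_. count_space UNIV) \<rightarrow>\<^sub>M subprob_algebra (count_space UNIV)"
    for t
  proof (cases t)
    case 0
    have "(\<lambda>\<omega>. measure_pmf \<mu>) \<in> PiM {0..<t} (\<lambda>_. count_space UNIV) \<rightarrow>\<^sub>M subprob_algebra (count_space UNIV)"
      by (rule measurable_const) (simp add: measure_pmf_in_subprob_algebra)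
    then show ?thesis
      using 0 by (simp add: mc_kernel_def[abs_def])
  next
    case (Suc s)
    have "(\<lambda>\<omega>. \<omega> s) \<in> PiM {0..<t} (\<lambda>_. count_space UNIV) \<rightarrow>\<^sub>M count_space UNIV"
      using Suc by (intro measurable_component_singleton) auto
    moreover have "(\<lambda>x. measure_pmf (K x)) \<in> count_space UNIV \<rightarrow>\<^sub>M subprob_algebra (count_space UNIV)"
      by (auto simp: measure_pmf_in_subprob_algebra)
    ultimately have "(\<lambda>\<omega>. measure_pmf (K (\<omega> s)))
        \<in> PiM {0..<t} (\<lambda>_. count_space UNIV) \<rightarrow>\<^sub>M subprob_algebra (count_space UNIV)"
      by (rule measurable_compose)
    then show ?thesis
      using Suc by (simp add: mc_kernel_def[abs_def])
  qed
  show "prob_space (mc_kernel \<mu> K t \<omega>)"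
    if "\<omega> \<in> space (PiM {0..<t} (\<lambda>_. count_space UNIV))" for t \<omega>
    by (cases t) (simp_all add: mc_kernel_def prob_space_measure_pmf)
qed

lemma sets_mc_path [measurable_cong]: "sets (mc_path \<mu> K) = sets (PiM UNIV (\<lambda>_. count_space UNIV))"
proof -
  interpret IT: Ionescu_Tulcea "mc_kernel \<mu> K" "\<lambda>_. count_space UNIV"
    by (rule Ionescu_Tulcea_mc_kernel)
  show ?thesis
    unfolding mc_path_def by (rule IT.PF.sets_lim)
qed

lemma space_mc_path [simp]: "space (mc_path \<mu> K) = UNIV"
  using sets_eq_imp_space_eq[OF sets_mc_path] by (simp add: space_PiM)

lemma prob_space_mc_path: "prob_space (mc_path \<mu> K)"
proof -
  interpret IT: Ionescu_Tulcea "mc_kernel \<mu> K" "\<lambda>_. count_space UNIV"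
    by (rule Ionescu_Tulcea_mc_kernel)
  have "emeasure (mc_path \<mu> K) (IT.PF.emb UNIV {} {\<lambda>_. undefined})
      = emeasure (IT.CI {}) {\<lambda>_. undefined}"
    unfolding mc_path_def by (rule IT.lim) (auto simp: PiM_empty)
  also have "{\<lambda>_. undefined} = space (IT.CI {})"
    by (simp add: IT.CI_def space_PiM)
  also have "emeasure (IT.CI {}) (space (IT.CI {})) = 1"
    by (rule prob_space.emeasure_space_1[OF IT.PF.prob_space_P]) auto
  also have "IT.PF.emb UNIV {} (space (IT.CI {})) = space (mc_path \<mu> K)"
    by (auto simp: prod_emb_def space_PiM IT.CI_def restrict_def)
  finally show ?thesis
    by (rule prob_spaceI)
qed

lemma emeasure_mc_path_prefix:
  "emeasure (mc_path \<mu> K) {\<omega>. \<forall>i<t. \<omega> i = x i}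
     = (\<Prod>i<t. emeasure (mc_kernel \<mu> K i x) {x i})"
proof -
  interpret IT: Ionescu_Tulcea "mc_kernel \<mu> K" "\<lambda>_. count_space UNIV"
    by (rule Ionescu_Tulcea_mc_kernel)
  let ?r = "\<lambda>t. restrict x {0..<t}"
  let ?u = "\<lambda>_::nat. undefined"
  have sets: "{?r t} \<in> sets (PiM {0..<t} (\<lambda>_. count_space UNIV))" for t
  proof -
    have "{?r t} = PiE {0..<t} (\<lambda>i. {x i})"
      by (auto simp: PiE_iff extensional_def fun_eq_iff)
    then show ?thesis
      by (simp add: sets_PiM_I_finite)
  qed
  have u: "?u \<in> space (PiM {0..<0} (\<lambda>_. count_space UNIV))"
    by (simp add: space_PiM)
  have C: "emeasure (IT.C 0 t ?u) {?r t} = (\<Prod>i<t. emeasure (mc_kernel \<mu> K i x) {x i})" for t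
  proof (induction t)
    case 0
    show ?case
      by (simp add: PiM_empty restrict_def)
  next
    case (Suc t)
    have spc: "space (IT.C 0 t ?u) = space (PiM {0..<t} (\<lambda>_. count_space UNIV))"
      using IT.space_C[OF u, of t] by simp
    have setsc: "sets (IT.C 0 t ?u) = sets (PiM {0..<t} (\<lambda>_. count_space UNIV))"
      using IT.sets_C[OF u, of t] by simp
    have ne: "space (IT.C 0 t ?u) \<noteq> {}"
      by (rule prob_space.not_empty[OF IT.prob_space_C[OF u]])
    have step: "emeasure (IT.eP t \<omega>) {?r (Suc t)}
        = emeasure (mc_kernel \<mu> K t x) {x t} * indicator {?r t} \<omega>"
      if \<omega>: "\<omega> \<in> space (IT.C 0 t ?u)" for \<omega>
    proof -
      have ext: "\<omega> i = undefined" if "\<not> i < t" for i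
        using \<omega> that unfolding spc by (auto simp: space_PiM PiE_iff extensional_def)
      have upd: "fun_upd \<omega> t y = ?r (Suc t) \<longleftrightarrow> \<omega> = ?r t \<and> y = x t" for y
        using ext by (auto simp: fun_eq_iff less_Suc_eq)
      have "emeasure (IT.eP t \<omega>) {?r (Suc t)}
          = emeasure (mc_kernel \<mu> K t \<omega>) ((\<lambda>y. fun_upd \<omega> t y) -` {?r (Suc t)} \<inter> space (count_space UNIV))"
        using \<omega> unfolding spc by (intro IT.emeasure_eP sets)
      also have "(\<lambda>y. fun_upd \<omega> t y) -` {?r (Suc t)} \<inter> space (count_space UNIV)
          = (if \<omega> = ?r t then {x t} else {})"
        using upd by auto
      also have "mc_kernel \<mu> K t (?r t) = mc_kernel \<mu> K t x"
        by (cases t) (auto simp: mc_kernel_def)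
      then have "emeasure (mc_kernel \<mu> K t \<omega>) (if \<omega> = ?r t then {x t} else {})
          = emeasure (mc_kernel \<mu> K t x) {x t} * indicator {?r t} \<omega>"
        by auto
      finally show ?thesis .
    qed
    have "emeasure (IT.C 0 (Suc t) ?u) {?r (Suc t)}
        = (\<integral>\<^sup>+\<omega>. emeasure (IT.eP t \<omega>) {?r (Suc t)} \<partial>IT.C 0 t ?u)"
      using IT.measurable_eP[of t] sets[of "Suc t"]
      by (simp, subst emeasure_bind[OF ne _ sets[of "Suc t"]])
         (auto simp: measurable_cong_sets[OF setsc refl])
    also have "\<dots> = (\<integral>\<^sup>+\<omega>. emeasure (mc_kernel \<mu> K t x) {x t} * indicator {?r t} \<omega> \<partial>IT.C 0 t ?u)"
      by (intro nn_integral_cong step)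
    also have "\<dots> = emeasure (mc_kernel \<mu> K t x) {x t} * emeasure (IT.C 0 t ?u) {?r t}"
      using sets[of t] setsc by (intro nn_integral_cmult_indicator) auto
    finally show ?case
      unfolding Suc.IH by (simp only: prod.lessThan_Suc mult.commute)
  qed
  have emb: "IT.PF.emb UNIV {0..<t} {?r t} = {\<omega>. \<forall>i<t. \<omega> i = x i}"
  proof (intro set_eqI iffI)
    fix \<omega> assume "\<omega> \<in> IT.PF.emb UNIV {0..<t} {?r t}"
    then have "restrict \<omega> {0..<t} i = ?r t i" for i
      by (simp add: prod_emb_def del: restrict_apply)
    then have "\<omega> i = x i" if "i < t" for i
      using that by (auto dest: meta_spec[of _ i] simp del: restrict_apply simp: restrict_apply')
    then show "\<omega> \<in> {\<omega>. \<forall>i<t. \<omega> i = x i}"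
      by simp
  next
    fix \<omega> assume "\<omega> \<in> {\<omega>. \<forall>i<t. \<omega> i = x i}"
    then show "\<omega> \<in> IT.PF.emb UNIV {0..<t} {?r t}"
      by (auto simp: prod_emb_def space_PiM intro!: restrict_ext)
  qed
  have "emeasure (mc_path \<mu> K) {\<omega>. \<forall>i<t. \<omega> i = x i} = emeasure (IT.CI {0..<t}) {?r t}"
    unfolding mc_path_def emb[symmetric] using sets by (intro IT.lim) auto
  also have "\<dots> = emeasure (IT.C 0 t ?u) (IT.PF.emb {0..<t} {0..<t} {?r t})"
    using sets by (intro IT.emeasure_CI) auto
  also have "IT.PF.emb {0..<t} {0..<t} {?r t} = {?r t}"
    by (rule prod_emb_id) (auto simp: space_PiM)
  finally show ?thesis
    by (simp add: C)
qed

lemma prob_mc_path_cylinder: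
  "\<P>(\<omega> in mc_path \<mu> K. \<forall>i\<le>t. \<omega> i = x i) = pmf \<mu> (x 0) * (\<Prod>i<t. pmf (K (x i)) (x (Suc i)))"
proof -
  have "emeasure (mc_path \<mu> K) {\<omega>. \<forall>i\<le>t. \<omega> i = x i}
      = (\<Prod>i<Suc t. emeasure (mc_kernel \<mu> K i x) {x i})"
    using emeasure_mc_path_prefix[of \<mu> K "Suc t" x] by (simp add: less_Suc_eq_le)
  also have "\<dots> = ennreal (pmf \<mu> (x 0)) * (\<Prod>i<t. ennreal (pmf (K (x i)) (x (Suc i))))"
    unfolding prod.lessThan_Suc_shift by (simp add: mc_kernel_def emeasure_pmf_single)
  also have "\<dots> = ennreal (pmf \<mu> (x 0) * (\<Prod>i<t. pmf (K (x i)) (x (Suc i))))"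
    by (simp add: prod_ennreal ennreal_mult prod_nonneg)
  finally show ?thesis
    by (simp add: measure_def prod_nonneg)
qed


section \<open>The rewire-to-random model\<close>

text \<open>
  The vertex set is \<open>{..<n}\<close>. A state consists of a placement of the labelled edges on pairs of
  vertices and of the opinions (\<open>False\<close> for 0, \<open>True\<close> for 1). The labels are the pairs that carry
  an edge initially; the domain of the placement is the set of labels and never changes.
  Opinions outside \<open>{..<n}\<close> are irrelevant and stay \<open>False\<close>.
\<close>

type_synonym state = "(nat set \<rightharpoonup> nat set) \<times> (nat \<Rightarrow> bool)"

definition erdos_renyi :: "nat \<Rightarrow> real \<Rightarrow> nat set set pmf" where
  "erdos_renyi n p =
     map_pmf (\<lambda>present. {e. present e})
       (Pi_pmf {e. e \<subseteq> {..<n} \<and> card e = 2} False (\<lambda>_. bernoulli_pmf p))"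

definition rtr_init :: "nat \<Rightarrow> state pmf" where
  "rtr_init n = do {
     E \<leftarrow> erdos_renyi n (1/2);
     op \<leftarrow> Pi_pmf {..<n} False (\<lambda>_. bernoulli_pmf (1/2));
     return_pmf (\<lambda>e. if e \<in> E then Some e else None, op)
   }"

definition disagreeing :: "state \<Rightarrow> nat set set" where
  "disagreeing = (\<lambda>(pl, op). {e. \<exists>u v. pl e = Some {u, v} \<and> op u \<noteq> op v})"

text \<open>
  For \<open>\<beta> / n > 1\<close>, outside the range of the model, \<open>bernoulli_pmf\<close> truncates its parameter to 1.
\<close>

definition rtr_step :: "real \<Rightarrow> nat \<Rightarrow> state \<Rightarrow> state pmf" where
  "rtr_step \<beta> n = (\<lambda>(pl, op).
     if disagreeing (pl, op) = {} then return_pmf (pl, op)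
     else do {
       e \<leftarrow> pmf_of_set (disagreeing (pl, op));
       u \<leftarrow> pmf_of_set (the (pl e));
       relabel \<leftarrow> bernoulli_pmf (\<beta> / real n);
       if relabel then
         (let v = the_elem (the (pl e) - {u}) in return_pmf (pl, op(u := op v)))
       else do {
         v' \<leftarrow> pmf_of_set ({..<n} - {u});
         return_pmf (pl(e \<mapsto> {u, v'}), op)
       }
     })"

definition rtr_chain :: "real \<Rightarrow> nat \<Rightarrow> (nat \<Rightarrow> state) measure" where
  "rtr_chain \<beta> n = mc_path (rtr_init n) (rtr_step \<beta> n)"

definition opinion_count :: "nat \<Rightarrow> bool \<Rightarrow> state \<Rightarrow> nat" where
  "opinion_count n c = (\<lambda>(pl, op). card {v \<in> {..<n}. op v = c})"

definition minority_count :: "nat \<Rightarrow> state \<Rightarrow> nat" where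
  "minority_count n s = min (opinion_count n False s) (opinion_count n True s)"

definition hitting_time :: "('s \<Rightarrow> bool) \<Rightarrow> (nat \<Rightarrow> 's) \<Rightarrow> enat" where
  "hitting_time P \<omega> = (INF t\<in>{t. P (\<omega> t)}. enat t)"

definition tau :: "(nat \<Rightarrow> state) \<Rightarrow> enat" where
  "tau = hitting_time (\<lambda>s. disagreeing s = {})"

definition tau_star :: "nat \<Rightarrow> real \<Rightarrow> (nat \<Rightarrow> state) \<Rightarrow> enat" where
  "tau_star n \<epsilon> = hitting_time (\<lambda>s. real (minority_count n s) \<le> \<epsilon> * real n)"


subsection \<open>Consistency checks\<close>

lemma hitting_time_never: "(\<And>t. \<not> P (\<omega> t)) \<Longrightarrow> hitting_time P \<omega> = \<infinity>"
  by (simp add: hitting_time_def top_enat_def)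

lemma hitting_time_Least:
  assumes "P (\<omega> t)"
  shows "hitting_time P \<omega> = enat (LEAST t. P (\<omega> t))"
  unfolding hitting_time_def
proof (rule antisym)
  show "(INF t\<in>{t. P (\<omega> t)}. enat t) \<le> enat (LEAST t. P (\<omega> t))"
    using LeastI[of "\<lambda>t. P (\<omega> t)", OF assms] by (auto intro: INF_lower)
  show "enat (LEAST t. P (\<omega> t)) \<le> (INF t\<in>{t. P (\<omega> t)}. enat t)"
    by (rule INF_greatest) (auto intro: Least_le)
qed

lemma measurable_hitting_time [measurable]:
  "hitting_time P \<in> PiM UNIV (\<lambda>_. count_space UNIV) \<rightarrow>\<^sub>M count_space UNIV"
proof -
  have P [measurable]: "Measurable.pred (PiM UNIV (\<lambda>_. count_space UNIV)) (\<lambda>\<omega>. P (\<omega> t))" for t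
    by (rule measurable_compose[OF measurable_component_singleton]) auto
  have "hitting_time P = (\<lambda>\<omega>. INF t. if P (\<omega> t) then enat t else \<infinity>)"
  proof
    fix \<omega>
    show "hitting_time P \<omega> = (INF t. if P (\<omega> t) then enat t else \<infinity>)"
      unfolding hitting_time_def
    proof (intro antisym INF_greatest)
      show "(INF t\<in>{t. P (\<omega> t)}. enat t) \<le> (if P (\<omega> t) then enat t else \<infinity>)" for t
        by (auto intro: INF_lower)
      show "(INF t. if P (\<omega> t) then enat t else \<infinity>) \<le> enat t" if "t \<in> {t. P (\<omega> t)}" for t
        using that INF_lower[of t UNIV "\<lambda>t. if P (\<omega> t) then enat t else \<infinity>"] by auto
    qed
  qed
  also have "\<dots> \<in> PiM UNIV (\<lambda>_. count_space UNIV) \<rightarrow>\<^sub>M count_space UNIV"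
    by measurable
  finally show ?thesis .
qed

lemma sets_tau_less_tau_star:
  "{\<omega> \<in> space (rtr_chain \<beta> n). tau \<omega> < tau_star n \<epsilon> \<omega>} \<in> sets (rtr_chain \<beta> n)"
proof -
  have [measurable]: "hitting_time P \<in> borel_measurable (rtr_chain \<beta> n)" for P
    using measurable_compose[OF measurable_hitting_time[of P], of "\<lambda>x. x" borel]
    by (simp add: rtr_chain_def measurable_cong_sets[OF sets_mc_path refl])
  show ?thesis
    unfolding tau_def tau_star_def by measurable
qed

definition wf_state :: "nat \<Rightarrow> state \<Rightarrow> bool" where
  "wf_state n = (\<lambda>(pl, op). finite (dom pl) \<and> ran pl \<subseteq> {e. e \<subseteq> {..<n} \<and> card e = 2})"

text \<open>
  In well-formed states, all arguments of \<open>pmf_of_set\<close> in \<open>rtr_step\<close> are finite and nonempty,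
  and the other endpoint is determined by the argument of \<open>the_elem\<close>.
\<close>

lemma rtr_step_choices:
  assumes "wf_state n (pl, op)"
  shows "finite (disagreeing (pl, op))"
    and "e \<in> disagreeing (pl, op) \<Longrightarrow> u \<in> the (pl e) \<Longrightarrow>
      finite (the (pl e)) \<and> {..<n} - {u} \<noteq> {} \<and> (\<exists>v<n. v \<noteq> u \<and> op v \<noteq> op u \<and> the (pl e) = {u, v} \<and>
        the_elem (the (pl e) - {u}) = v)"
proof -
  have "disagreeing (pl, op) \<subseteq> dom pl"
    by (auto simp: disagreeing_def)
  then show "finite (disagreeing (pl, op))"
    using assms by (auto simp: wf_state_def intro: finite_subset)
next
  assume "e \<in> disagreeing (pl, op)" and u: "u \<in> the (pl e)"
  then obtain a b where ab: "pl e = Some {a, b}" "op a \<noteq> op b"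
    by (auto simp: disagreeing_def)
  then have "a < n" "b < n" "a \<noteq> b"
    using assms by (auto simp: wf_state_def ran_def)
  obtain v where v: "v < n" "v \<noteq> u" "op v \<noteq> op u" "the (pl e) = {u, v}"
    using u ab \<open>a < n\<close> \<open>b < n\<close> \<open>a \<noteq> b\<close> by (cases "u = a") (auto simp: insert_commute)
  moreover have "{u, v} - {u} = {v}"
    using v by auto
  ultimately show "finite (the (pl e)) \<and> {..<n} - {u} \<noteq> {} \<and> (\<exists>v<n. v \<noteq> u \<and> op v \<noteq> op u \<and>
      the (pl e) = {u, v} \<and> the_elem (the (pl e) - {u}) = v)"
    by (intro conjI exI[of _ v]) auto
qed

lemma wf_state_init:
  assumes "s \<in> set_pmf (rtr_init n)"
  shows "wf_state n s"
proof -
  let ?A = "{e. e \<subseteq> {..<n} \<and> card e = 2}"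
  have fin: "finite ?A"
    by simp
  from assms obtain E op where E: "E \<in> set_pmf (erdos_renyi n (1/2))"
    and s: "s = (\<lambda>e. if e \<in> E then Some e else None, op)"
    by (auto simp: rtr_init_def)
  have "E \<subseteq> ?A"
    using E set_Pi_pmf_subset[OF fin, of False "\<lambda>_. bernoulli_pmf (1/2)"]
    by (auto simp: erdos_renyi_def)
  then show ?thesis
    using finite_subset[OF \<open>E \<subseteq> ?A\<close> fin]
    by (auto simp: s wf_state_def dom_def ran_def split: if_splits)
qed

lemma wf_state_step:
  assumes wf: "wf_state n s" and s': "s' \<in> set_pmf (rtr_step \<beta> n s)"
  shows "wf_state n s'"
proof (cases "disagreeing s = {}")
  case True
  then show ?thesis
    using assms by (auto simp: rtr_step_def split: prod.splits)
next
  case False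
  obtain pl op where s: "s = (pl, op)"
    by (cases s)
  note choices = rtr_step_choices[OF wf[unfolded s]]
  note ne = False[unfolded s]
  from s' obtain e u b where e: "e \<in> disagreeing (pl, op)" and u: "u \<in> set_pmf (pmf_of_set (the (pl e)))"
    and *: "s' \<in> set_pmf (if b then (let v = the_elem (the (pl e) - {u}) in return_pmf (pl, op(u := op v)))
       else do { v' \<leftarrow> pmf_of_set ({..<n} - {u}); return_pmf (pl(e \<mapsto> {u, v'}), op) })"
    using ne choices(1) by (auto simp: rtr_step_def s)
  obtain a c where ac: "pl e = Some {a, c}" "op a \<noteq> op c"
    using e by (auto simp: disagreeing_def)
  then have u': "u \<in> the (pl e)"
    using u by simp
  have un: "u < n"
    using wf u' ac by (auto simp: s wf_state_def ran_def)
  have ne': "{..<n} - {u} \<noteq> {}"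
    using choices(2)[OF e u'] by auto
  show ?thesis
  proof (cases b)
    case True
    then show ?thesis
      using * wf by (auto simp: s wf_state_def)
  next
    case False
    then obtain v' where v': "v' < n" "v' \<noteq> u" and eq: "s' = (pl(e \<mapsto> {u, v'}), op)"
      using * ne' by auto
    then show ?thesis
      using wf un by (auto simp: s wf_state_def ran_def card_insert_if)
  qed
qed

end

theory Submission
  imports Defs "HOL-Real_Asymp.Real_Asymp"
begin

text \<open>
  The number of vertices of either opinion is a martingale whose steps are \<open>\<plusminus>1\<close> with probability
  \<open>\<beta> / n\<close>, so over \<open>8 n\<^sup>2\<close> steps it moves by \<open>O(\<surd>n)\<close> only. Hence it suffices that, once
  the minority has shrunk to \<open>\<epsilon> n\<close>, all disagreement disappears within \<open>8 n\<^sup>2\<close> steps.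

  For small \<open>\<epsilon>\<close> the minority vertices with disagreeing edges behave like a subcritical branching
  process: a minority vertex of degree \<open>d\<close> converts \<open>1 - exp (- \<beta> d / n)\<close> vertices on average
  before it has lost its edges to rewiring or has been converted itself. So each minority vertex is
  given the weight \<open>1 - exp (- \<gamma> d)\<close> with \<open>\<gamma> \<approx> \<beta> / n\<close>. Subcriticality is uniform only while
  degrees are \<open>O(n)\<close>, so the at most \<open>n / 8\<close> hubs, the vertices of degree above \<open>8 n\<close> when the
  minority first becomes small, receive a constant weight, slightly below \<open>1\<close> but above the weight
  of every other vertex. This gives a negative drift except when an edge between two hubs is chosen;
  but such a step most likely destroys an edge between hubs, and there are at most \<open>n\<^sup>2 / 2\<close> of these
  to begin with. Adding a multiple of their number yields a function with uniformly negative drift.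
\<close>

section \<open>First-passage bounds for Markov chains\<close>

text \<open>
  \<open>miss A B K t s\<close> is the probability that the chain started in \<open>s\<close> fails to reach \<open>B\<close> within
  \<open>t\<close> steps strictly before it visits \<open>A\<close>.
\<close>

primrec miss :: "('s \<Rightarrow> bool) \<Rightarrow> ('s \<Rightarrow> bool) \<Rightarrow> ('s \<Rightarrow> 's pmf) \<Rightarrow> nat \<Rightarrow> 's \<Rightarrow> real" where
  "miss A B K 0 s = (if B s \<and> \<not> A s then 0 else 1)"
| "miss A B K (Suc t) s =
     (if A s then 1 else if B s then 0 else measure_pmf.expectation (K s) (miss A B K t))"

lemma miss_nonneg: "0 \<le> miss A B K t s"
  by (induction t arbitrary: s) (auto intro!: Bochner_Integration.integral_nonneg)

lemma miss_le_1: "miss A B K t s \<le> 1"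
proof (induction t arbitrary: s)
  case (Suc t)
  have "measure_pmf.expectation (K s) (miss A B K t) \<le> 1"
    using Suc.IH miss_nonneg[of A B K t]
    by (intro measure_pmf.integral_le_const measure_pmf.integrable_const_bound[of _ 1])
       (auto simp: abs_le_iff intro!: AE_I2)
  then show ?case by simp
qed simp

text \<open>
  Besides stopping at \<open>A\<close> or \<open>B\<close>, the potential may be abandoned at \<open>E\<close>, where a bound valid for every
  remaining time \<open>t \<ge> r\<close> is already known. No drift is needed where \<open>V \<ge> 1\<close>, so a term that reaches
  \<open>1\<close> as soon as some event occurs lets the drift proof assume that the event has not occurred.
\<close>

lemma miss_le_potential:
  fixes V :: "nat \<Rightarrow> 's \<Rightarrow> real"
  assumes fin: "\<And>s. I s \<Longrightarrow> finite (set_pmf (K s))"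
    and closed: "\<And>s s'. I s \<Longrightarrow> \<not> A s \<Longrightarrow> \<not> B s \<Longrightarrow> \<not> E s \<Longrightarrow> s' \<in> set_pmf (K s) \<Longrightarrow> I s'"
    and nonneg: "\<And>k s. I s \<Longrightarrow> 0 \<le> V k s"
    and fin_V: "\<And>s. I s \<Longrightarrow> 1 \<le> V T s"
    and A_V: "\<And>k s. I s \<Longrightarrow> k < T \<Longrightarrow> A s \<Longrightarrow> 1 \<le> V k s"
    and exit: "\<And>k t s. I s \<Longrightarrow> k < T \<Longrightarrow> E s \<Longrightarrow> r \<le> t \<Longrightarrow> miss A B K t s \<le> V k s"
    and drift: "\<And>k s. I s \<Longrightarrow> k < T \<Longrightarrow> \<not> A s \<Longrightarrow> \<not> B s \<Longrightarrow> \<not> E s \<Longrightarrow> V k s < 1 \<Longrightarrow>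
      measure_pmf.expectation (K s) (V (Suc k)) \<le> V k s"
  shows "I s \<Longrightarrow> k \<le> T \<Longrightarrow> r + T \<le> t + k \<Longrightarrow> miss A B K t s \<le> V k s"
proof (induction "T - k" arbitrary: k t s)
  case 0
  then show ?case
    using fin_V[of s] miss_le_1[of A B K t s] by auto
next
  case (Suc m)
  then have k: "k < T" by simp
  consider "1 \<le> V k s" | "E s" | "V k s < 1" "A s" | "V k s < 1" "\<not> A s" "B s"
    | "V k s < 1" "\<not> A s" "\<not> B s" "\<not> E s"
    by fastforce
  then show ?case
  proof cases
    case 1
    then show ?thesis
      using miss_le_1[of A B K t s] by linarith
  next
    case 2
    then show ?thesis
      using Suc exit[of s k t] k by auto
  next
    case 3
    then show ?thesis
      using A_V[OF Suc.prems(1) k] by simp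
  next
    case 4
    then show ?thesis
      using nonneg[OF Suc.prems(1)] by (cases t) auto
  next
    case 5
    \<comment> \<open>Since \<open>k < T\<close> and \<open>r + T \<le> t + k\<close>, at least one
      step is left, and after it the inequality still holds with \<open>t'\<close> and
      \<open>Suc k\<close>.\<close>
    obtain t' where t: "t = Suc t'"
      using Suc.prems k by (cases t) auto
    have "measure_pmf.expectation (K s) (miss A B K t') \<le> measure_pmf.expectation (K s) (V (Suc k))"
    proof (intro integral_mono_AE integrable_measure_pmf_finite fin Suc.prems)
      show "AE s' in measure_pmf (K s). miss A B K t' s' \<le> V (Suc k) s'"
        unfolding AE_measure_pmf_iff
        using Suc.hyps Suc.prems k t 5 by (auto intro!: Suc.hyps(1) closed[OF Suc.prems(1)])
    qed
    also have "\<dots> \<le> V k s"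
      using drift[OF Suc.prems(1) k] 5 by simp
    finally show ?thesis
      using 5 by (simp add: t)
  qed
qed

text \<open>Conditionally on a history that has avoided \<open>A\<close>, the event \<open>G\<close>
  has probability at least one minus \<open>miss\<close>. Splitting a prefix according to its next
  state turns the recursion of \<open>miss\<close> into a sum over disjoint cylinders. The product
  form avoids conditioning on null cylinders, and \<open>G\<close> is only required to contain the
  event that \<open>B\<close> occurs with no visit to \<open>A\<close> so far.\<close>

lemma prob_prefix_success:
  fixes \<mu> :: "'s pmf" and K :: "'s \<Rightarrow> 's pmf"
  defines "M \<equiv> mc_path \<mu> K"
  assumes fin: "\<And>s. I s \<Longrightarrow> finite (set_pmf (K s))"
    and closed: "\<And>s s'. I s \<Longrightarrow> s' \<in> set_pmf (K s) \<Longrightarrow> I s'"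
    and G: "G \<in> sets M" "\<And>\<omega> j. B (\<omega> j) \<Longrightarrow> (\<And>i. i \<le> j \<Longrightarrow> \<not> A (\<omega> i)) \<Longrightarrow> \<omega> \<in> G"
  shows "I (x j) \<Longrightarrow> (\<And>i. i < j \<Longrightarrow> \<not> A (x i)) \<Longrightarrow>
    measure M {\<omega>. \<forall>i\<le>j. \<omega> i = x i} * (1 - miss A B K t (x j))
      \<le> measure M (G \<inter> {\<omega>. \<forall>i\<le>j. \<omega> i = x i})"
proof (induction t arbitrary: x j)
  have sets_prefix: "{\<omega>. \<forall>i\<le>j. \<omega> i = x i} \<in> sets M" for x :: "nat \<Rightarrow> 's" and j
  proof -
    have "{\<omega>. \<forall>i\<le>j. \<omega> i = x i} = {\<omega>\<in>space M. \<forall>i\<in>{..j}. \<omega> i = x i}"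
      by (auto simp: M_def)
    also have "\<dots> \<in> sets M"
    proof (intro sets.sets_Collect_finite_All)
      fix i
      have "(\<lambda>\<omega>. \<omega> i) \<in> M \<rightarrow>\<^sub>M count_space UNIV"
        unfolding M_def measurable_cong_sets[OF sets_mc_path refl] by (rule measurable_component_singleton) simp
      then show "{\<omega> \<in> space M. \<omega> i = x i} \<in> sets M"
        by measurable
    qed simp
    finally show ?thesis .
  qed
  interpret prob_space M
    unfolding M_def by (rule prob_space_mc_path)
  {
    fix x :: "nat \<Rightarrow> 's" and j
    assume B: "B (x j)" "\<not> A (x j)" "\<And>i. i < j \<Longrightarrow> \<not> A (x i)"
    have "{\<omega>. \<forall>i\<le>j. \<omega> i = x i} \<subseteq> G"
      using B by (auto intro!: G(2)[of _ j] simp: le_less)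
    then have "measure M {\<omega>. \<forall>i\<le>j. \<omega> i = x i} \<le> measure M (G \<inter> {\<omega>. \<forall>i\<le>j. \<omega> i = x i})"
      by (simp add: Int_absorb1)
  } note hit = this
  {
    case 0
    then show ?case
      using hit[of x j] by auto
  next
    case (Suc t)
    let ?P = "\<lambda>x j. {\<omega>. \<forall>i\<le>j. \<omega> i = x i}"
    show ?case
    proof (cases "A (x j) \<or> B (x j)")
      case True
      then show ?thesis
        using hit[of x j] Suc.prems by auto
    next
      case False
      let ?S = "set_pmf (K (x j))"
      let ?x = "\<lambda>y. x(Suc j := y)"
      note finS = fin[OF Suc.prems(1)]
      have m: "measure M (?P (?x y) (Suc j)) = measure M (?P x j) * pmf (K (x j)) y" for y
      proof -
        have "(\<Prod>i<j. pmf (K (x i)) (?x y (Suc i))) = (\<Prod>i<j. pmf (K (x i)) (x (Suc i)))"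
          by (intro prod.cong) auto
        then show ?thesis
          using prob_mc_path_cylinder[of \<mu> K "Suc j" "?x y"] prob_mc_path_cylinder[of \<mu> K j x]
          by (simp add: M_def)
      qed
      have "measure M (?P x j) * (1 - measure_pmf.expectation (K (x j)) (miss A B K t))
          = measure M (?P x j) * (\<Sum>y\<in>?S. pmf (K (x j)) y * (1 - miss A B K t y))"
        by (subst integral_measure_pmf[OF finS])
           (auto simp: algebra_simps sum_subtractf sum_pmf_eq_1[OF finS])
      also have "\<dots> = (\<Sum>y\<in>?S. measure M (?P (?x y) (Suc j)) * (1 - miss A B K t (?x y (Suc j))))"
        by (simp only: m fun_upd_same sum_distrib_left mult.assoc)
      also have "\<dots> \<le> (\<Sum>y\<in>?S. measure M (G \<inter> ?P (?x y) (Suc j)))"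
      proof (intro sum_mono Suc.IH)
        show "I (?x y (Suc j))" if "y \<in> ?S" for y
          using closed[OF Suc.prems(1) that] by simp
        show "\<not> A (?x y i)" if "i < Suc j" for i y
          using that False Suc.prems(2)[of i] by (auto simp: less_Suc_eq)
      qed
      also have "\<dots> = measure M (\<Union>y\<in>?S. G \<inter> ?P (?x y) (Suc j))"
      proof (rule finite_measure_finite_Union[symmetric, OF finS])
        show "(\<lambda>y. G \<inter> ?P (?x y) (Suc j)) ` ?S \<subseteq> sets M"
          using sets.Int[OF G(1) sets_prefix] by blast
        show "disjoint_family_on (\<lambda>y. G \<inter> ?P (?x y) (Suc j)) ?S"
          by (auto simp: disjoint_family_on_def dest!: spec[of _ "Suc j"])
      qed
      also have "\<dots> \<le> measure M (G \<inter> ?P x j)"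
        using sets_prefix G(1) by (intro finite_measure_mono) (auto split: if_splits)
      finally show ?thesis
        using False by simp
    qed
  }
qed

text \<open>The transfer from \<open>miss\<close> to the path measure: decompose by the initial
  state, and charge the states outside \<open>J\<close> with the trivial bound 1.\<close>

lemma prob_success_ge:
  fixes \<mu> :: "'s pmf" and K :: "'s \<Rightarrow> 's pmf"
  defines "M \<equiv> mc_path \<mu> K"
  assumes fin: "finite (set_pmf \<mu>)" "\<And>s. I s \<Longrightarrow> finite (set_pmf (K s))"
    and init: "\<And>s. s \<in> set_pmf \<mu> \<Longrightarrow> I s"
    and closed: "\<And>s s'. I s \<Longrightarrow> s' \<in> set_pmf (K s) \<Longrightarrow> I s'"
    and G: "G \<in> sets M" "\<And>\<omega> j. B (\<omega> j) \<Longrightarrow> (\<And>i. i \<le> j \<Longrightarrow> \<not> A (\<omega> i)) \<Longrightarrow> \<omega> \<in> G"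
    and bound: "\<And>s. s \<in> set_pmf \<mu> \<Longrightarrow> J s \<Longrightarrow> miss A B K t s \<le> \<delta>" and "0 \<le> \<delta>"
  shows "1 - measure_pmf.prob \<mu> {s. \<not> J s} - \<delta> \<le> measure M G"
proof -
  interpret prob_space M
    unfolding M_def by (rule prob_space_mc_path)
  let ?P = "\<lambda>y. {\<omega>. \<forall>i\<le>(0::nat). \<omega> i = y}"
  have sets: "?P y \<in> sets M" for y
  proof -
    have "(\<lambda>\<omega>. \<omega> 0) \<in> M \<rightarrow>\<^sub>M count_space UNIV"
      unfolding M_def measurable_cong_sets[OF sets_mc_path refl] by (rule measurable_component_singleton) simp
    then have "{\<omega>\<in>space M. \<omega> 0 = y} \<in> sets M"
      by measurable
    then show ?thesis
      by (simp add: M_def)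
  qed
  have "1 - \<delta> - measure_pmf.prob \<mu> {s. \<not> J s}
      = (\<Sum>y\<in>set_pmf \<mu>. pmf \<mu> y * (1 - \<delta> - (if J y then 0 else 1)))"
  proof -
    have "measure_pmf.prob \<mu> {s. \<not> J s} = measure_pmf.expectation \<mu> (indicator {s. \<not> J s})"
      by simp
    also have "\<dots> = (\<Sum>y\<in>set_pmf \<mu>. pmf \<mu> y * (if J y then 0 else 1))"
      by (subst integral_measure_pmf[OF fin(1)]) (auto simp: indicator_def intro!: sum.cong)
    finally show ?thesis
      by (simp add: right_diff_distrib sum_subtractf flip: sum_distrib_right)
         (simp add: sum_pmf_eq_1[OF fin(1)])
  qed
  also have "\<dots> \<le> (\<Sum>y\<in>set_pmf \<mu>. pmf \<mu> y * (1 - miss A B K t y))"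
  proof (intro sum_mono mult_left_mono)
    show "1 - \<delta> - (if J y then 0 else 1) \<le> 1 - miss A B K t y" if "y \<in> set_pmf \<mu>" for y
      using bound[OF that] miss_le_1[of A B K t y] \<open>0 \<le> \<delta>\<close> by auto
  qed simp
  also have "\<dots> = (\<Sum>y\<in>set_pmf \<mu>. measure M (?P y) * (1 - miss A B K t y))"
  proof -
    have "measure M (?P y) = pmf \<mu> y" for y
      using prob_mc_path_cylinder[of \<mu> K 0 "\<lambda>_. y"] by (simp add: M_def)
    then show ?thesis by simp
  qed
  also have "\<dots> \<le> (\<Sum>y\<in>set_pmf \<mu>. measure M (G \<inter> ?P y))"
  proof (rule sum_mono)
    fix y assume "y \<in> set_pmf \<mu>"
    then show "measure M (?P y) * (1 - miss A B K t y) \<le> measure M (G \<inter> ?P y)"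
      using prob_prefix_success[where \<mu>=\<mu> and K=K and I=I and G=G and A=A and B=B
          and x="\<lambda>_. y" and j=0 and t=t] fin(2) closed G init
      unfolding M_def by blast
  qed
  also have "\<dots> = measure M (\<Union>y\<in>set_pmf \<mu>. G \<inter> ?P y)"
    using fin(1) sets G(1)
    by (intro finite_measure_finite_Union[symmetric]) (auto simp: disjoint_family_on_def)
  also have "\<dots> \<le> measure M G"
    using G(1) by (intro finite_measure_mono) auto
  finally show ?thesis
    by simp
qed

section \<open>Averaging over one step\<close>

lemma disagreeing_edgeE:
  assumes "wf_state n (pl, op)" "e \<in> disagreeing (pl, op)"
  obtains a b where "pl e = Some {a, b}" "a < n" "b < n" "op a = c" "op b = (\<not> c)"
proof -
  obtain u v where uv: "pl e = Some {u, v}" "op u \<noteq> op v"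
    using assms(2) by (auto simp: disagreeing_def)
  then have "{u, v} \<subseteq> {..<n}"
    using assms(1) by (auto simp: wf_state_def ran_def)
  then show thesis
    using that[of u v] that[of v u] uv by (cases "op u = c") (auto simp: insert_commute)
qed

lemma finite_set_rtr_step:
  assumes "wf_state n s"
  shows "finite (set_pmf (rtr_step \<beta> n s))"
proof (cases "disagreeing s = {}")
  case False
  obtain pl op where s: "s = (pl, op)" by (cases s)
  have *: "finite (set_pmf (pmf_of_set (the (pl e))))" 
      "u \<in> set_pmf (pmf_of_set (the (pl e))) \<Longrightarrow> finite (set_pmf (pmf_of_set ({..<n} - {u})))"
      if e: "e \<in> disagreeing (pl, op)" for e u
  proof -
    obtain a b where ab: "pl e = Some {a, b}" "a < n" "b < n" "op a = True" "op b = (\<not> True)"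
      using disagreeing_edgeE[OF assms[unfolded s] e] .
    then have "the (pl e) \<noteq> {}" "finite (the (pl e))" "a \<noteq> b"
      by auto
    then show "finite (set_pmf (pmf_of_set (the (pl e))))"
      by simp
    have "{..<n} - {u} \<noteq> {}"
      using ab \<open>a \<noteq> b\<close> by (cases "u = a") auto
    then show "finite (set_pmf (pmf_of_set ({..<n} - {u})))"
      by simp
  qed
  show ?thesis
    using False * rtr_step_choices(1)[OF assms[unfolded s]]
    by (auto simp: rtr_step_def s Let_def)
qed (auto simp: rtr_step_def split: prod.splits)

text \<open>Root and outcome are averaged out while the edge stays fixed, because nothing is known
  about the composition of the set of disagreeing edges. The factor \<open>real n - 1\<close> is the
  number of possible new endpoints.\<close>

definition edge_mean ::
  "real \<Rightarrow> nat \<Rightarrow> (state \<Rightarrow> real) \<Rightarrow> state \<Rightarrow> nat set \<Rightarrow> nat \<Rightarrow> nat \<Rightarrow> real" where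
  "edge_mean \<beta> n F = (\<lambda>(pl, op) e a b.
     (\<beta> / n * (F (pl, op(a := op b)) + F (pl, op(b := op a)))
      + (1 - \<beta> / n) * ((\<Sum>w\<in>{..<n} - {a}. F (pl(e \<mapsto> {a, w}), op))
          + (\<Sum>w\<in>{..<n} - {b}. F (pl(e \<mapsto> {b, w}), op))) / (real n - 1)) / 2)"

text \<open>The one-step expectation is the uniform average of \<open>edge_mean\<close> over the
  disagreeing edges, so a bound for each single edge suffices. Each edge is oriented so that
  \<open>a\<close> carries the opinion \<open>c\<close> being tracked.\<close>

lemma expectation_rtr_step_le:
  fixes F :: "state \<Rightarrow> real" and \<beta> :: real
  assumes wf: "wf_state n s" and dis: "disagreeing s \<noteq> {}" and \<beta>: "0 < \<beta>" "\<beta> < n"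
    and bound: "\<And>e a b. fst s e = Some {a, b} \<Longrightarrow> a < n \<Longrightarrow> b < n \<Longrightarrow> snd s a = c \<Longrightarrow>
      snd s b = (\<not> c) \<Longrightarrow> edge_mean \<beta> n F s e a b \<le> X"
  shows "measure_pmf.expectation (rtr_step \<beta> n s) F \<le> X"
proof -
  obtain pl op where s: "s = (pl, op)" by (cases s)
  let ?D = "disagreeing s"
  let ?r = "\<lambda>e u. bernoulli_pmf (\<beta> / n) \<bind> (\<lambda>relabel. if relabel
      then (let v = the_elem (the (pl e) - {u}) in return_pmf (pl, op(u := op v)))
      else pmf_of_set ({..<n} - {u}) \<bind> (\<lambda>v'. return_pmf (pl(e \<mapsto> {u, v'}), op)))"
  let ?q = "\<lambda>e. pmf_of_set (the (pl e)) \<bind> ?r e"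
  have finD: "finite ?D"
    using rtr_step_choices(1)[OF wf[unfolded s]] by (simp add: s)
  have eq: "rtr_step \<beta> n s = pmf_of_set ?D \<bind> ?q"
    using dis by (simp add: rtr_step_def s)
  have r: "measure_pmf.expectation (?r e u) F
      = \<beta> / n * F (pl, op(u := op v)) + (1 - \<beta> / n) * (\<Sum>w\<in>{..<n} - {u}. F (pl(e \<mapsto> {u, w}), op)) / (real n - 1)"
      (is ?E) and r_fin: "finite (set_pmf (?r e u))" (is ?F)
    if "the (pl e) = {u, v}" "u \<noteq> v" "u < n" "v < n" for e u v
  proof -
    have v: "the_elem (the (pl e) - {u}) = v"
    proof -
      have "the (pl e) - {u} = {v}"
        using that by auto
      then show ?thesis by simp
    qed
    have ne: "{..<n} - {u} \<noteq> {}"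
      using that by auto
    have card: "real (card ({..<n} - {u})) = real n - 1"
      using that by (simp add: of_nat_diff)
    show ?E
      using ne \<beta>
      by (subst pmf_expectation_bind[of UNIV])
         (auto simp: UNIV_bool pmf_expectation_bind_pmf_of_set card v sum_divide_distrib
            field_simps sum_distrib_left Let_def)
    show ?F
      using ne by (auto simp: v Let_def)
  qed
  have q: "measure_pmf.expectation (?q e) F \<le> X" and q_fin: "finite (set_pmf (?q e))"
    if e: "e \<in> ?D" for e
  proof -
    obtain a b where ab: "pl e = Some {a, b}" "a < n" "b < n" "op a = c" "op b = (\<not> c)"
      using disagreeing_edgeE[of n pl op e c] wf e by (auto simp: s)
    have ne: "a \<noteq> b"
      using ab by auto
    have ba: "the (pl e) = {b, a}" "the (pl e) = {a, b}"
      using ab by auto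
    have set: "set_pmf (pmf_of_set (the (pl e))) = {a, b}"
      using ab by simp
    have "measure_pmf.expectation (?q e) F
        = (\<Sum>u\<in>{a, b}. measure_pmf.expectation (?r e u) F / 2)"
      using r_fin[OF ba(2)] r_fin[OF ba(1)] ab ne
      by (subst pmf_expectation_bind[of "{a, b}"]) (auto simp: ba(2))
    also have "\<dots> = edge_mean \<beta> n F s e a b"
      using r[OF ba(2)] r[OF ba(1)] ab ne
      by (simp add: edge_mean_def s add_divide_distrib distrib_left)
    also have "\<dots> \<le> X"
      using bound[of e a b] ab by (simp add: s)
    finally show "measure_pmf.expectation (?q e) F \<le> X" .
    show "finite (set_pmf (?q e))"
      using r_fin[OF ba(2)] r_fin[OF ba(1)] ab ne by (auto simp: set)
  qed
  have "measure_pmf.expectation (rtr_step \<beta> n s) F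
      = (\<Sum>e\<in>?D. measure_pmf.expectation (?q e) F / real (card ?D))"
    unfolding eq using dis finD q_fin
    by (subst pmf_expectation_bind_pmf_of_set) (auto simp: field_simps)
  also have "\<dots> \<le> (\<Sum>e\<in>?D. X / real (card ?D))"
    by (intro sum_mono divide_right_mono q) auto
  also have "\<dots> = X"
    using dis finD by simp
  finally show ?thesis .
qed

text \<open>\<open>A1\<close> and \<open>B1\<close> account for relabelling \<open>a\<close> and
  \<open>b\<close>, \<open>A2\<close> and \<open>B2\<close> for a rewiring with that root, and
  \<open>G\<close> for the new endpoint. As \<open>G\<close> is nonnegative, its sum may include the
  root, which makes it the same for both roots.\<close>

lemma edge_mean_le:
  fixes F :: "state \<Rightarrow> real" and \<beta> :: real
  assumes \<beta>: "0 < \<beta>" "\<beta> < n" and ab: "a < n" "b < n" "a \<noteq> b"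
    and relabel: "F (pl, op(a := op b)) \<le> A1" "F (pl, op(b := op a)) \<le> B1"
    and rewire: "\<And>w. w < n \<Longrightarrow> w \<noteq> a \<Longrightarrow> F (pl(e \<mapsto> {a, w}), op) \<le> A2 + G w"
      "\<And>w. w < n \<Longrightarrow> w \<noteq> b \<Longrightarrow> F (pl(e \<mapsto> {b, w}), op) \<le> B2 + G w"
    and G: "\<And>w. w < n \<Longrightarrow> 0 \<le> G w"
  shows "edge_mean \<beta> n F (pl, op) e a b
    \<le> \<beta> / n * ((A1 + B1) / 2) + (1 - \<beta> / n) * ((A2 + B2) / 2 + (\<Sum>w<n. G w) / (real n - 1))"
proof -
  have n: "real n - 1 > 0"
    using ab by linarith
  have *: "(\<Sum>w\<in>{..<n} - {u}. f w) \<le> (real n - 1) * x + (\<Sum>w<n. G w)"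
    if "u < n" "\<And>w. w < n \<Longrightarrow> w \<noteq> u \<Longrightarrow> f w \<le> x + G w" for u f x
  proof -
    have "(\<Sum>w\<in>{..<n} - {u}. f w) \<le> (\<Sum>w\<in>{..<n} - {u}. x + G w)"
      using that by (intro sum_mono) auto
    also have "\<dots> = (real n - 1) * x + (\<Sum>w\<in>{..<n} - {u}. G w)"
      using that by (simp add: sum.distrib of_nat_diff)
    also have "(\<Sum>w\<in>{..<n} - {u}. G w) \<le> (\<Sum>w<n. G w)"
      using G by (intro sum_mono2) auto
    finally show ?thesis by simp
  qed
  define SA where "SA = (\<Sum>w\<in>{..<n} - {a}. F (pl(e \<mapsto> {a, w}), op))"
  define SB where "SB = (\<Sum>w\<in>{..<n} - {b}. F (pl(e \<mapsto> {b, w}), op))"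
  have "(SA + SB) / (real n - 1) \<le> ((real n - 1) * (A2 + B2) + 2 * (\<Sum>w<n. G w)) / (real n - 1)"
    using *[of a "\<lambda>w. F (pl(e \<mapsto> {a, w}), op)" A2] *[of b "\<lambda>w. F (pl(e \<mapsto> {b, w}), op)" B2] ab rewire n
    by (intro divide_right_mono) (auto simp: SA_def SB_def algebra_simps)
  also have "\<dots> = A2 + B2 + 2 * ((\<Sum>w<n. G w) / (real n - 1))"
    using n by (simp add: field_simps)
  finally have "(1 - \<beta> / n) * ((SA + SB) / (real n - 1))
      \<le> (1 - \<beta> / n) * (A2 + B2 + 2 * ((\<Sum>w<n. G w) / (real n - 1)))"
    using \<beta> by (intro mult_left_mono) (auto simp: field_simps)
  moreover have "\<beta> / n * (F (pl, op(a := op b)) + F (pl, op(b := op a))) \<le> \<beta> / n * (A1 + B1)"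
    using \<beta> relabel by (intro mult_left_mono) auto
  moreover have "edge_mean \<beta> n F (pl, op) e a b
      = (\<beta> / n * (F (pl, op(a := op b)) + F (pl, op(b := op a)))
        + (1 - \<beta> / n) * ((SA + SB) / (real n - 1))) / 2"
    by (simp add: edge_mean_def SA_def SB_def)
  ultimately have "edge_mean \<beta> n F (pl, op) e a b
      \<le> (\<beta> / n * (A1 + B1) + (1 - \<beta> / n) * (A2 + B2 + 2 * ((\<Sum>w<n. G w) / (real n - 1)))) / 2"
    by (simp only:) (intro divide_right_mono add_mono; simp)
  also have "\<dots> = \<beta> / n * ((A1 + B1) / 2)
      + (1 - \<beta> / n) * ((A2 + B2) / 2 + (\<Sum>w<n. G w) / (real n - 1))"
    by argo
  finally show ?thesis .
qed

section \<open>Observables\<close>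

definition edge_count :: "state \<Rightarrow> (nat set \<Rightarrow> bool) \<Rightarrow> nat" where
  "edge_count s P = card {e \<in> dom (fst s). P (the (fst s e))}"

abbreviation deg :: "state \<Rightarrow> nat \<Rightarrow> nat" where
  "deg s v \<equiv> edge_count s (\<lambda>y. v \<in> y)"

lemma edge_count_upd_opinion [simp]: "edge_count (pl, op(u := c)) P = edge_count (pl, op) P"
  by (simp add: edge_count_def)

lemma edge_count_upd:
  assumes "finite (dom pl)" "pl e = Some y"
  shows "real (edge_count (pl(e \<mapsto> z), op) P)
    = real (edge_count (pl, op) P) + of_bool (P z) - of_bool (P y)"
proof -
  have split: "real (card {e \<in> D. Q e}) = of_bool (Q e) + real (card {e' \<in> D - {e}. Q e'})"
    if "e \<in> D" "finite D" for D :: "nat set set" and Q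
  proof -
    have "{e \<in> D. Q e} = (if Q e then insert e {e' \<in> D - {e}. Q e'} else {e' \<in> D - {e}. Q e'})"
      using that by auto
    then show ?thesis
      using that by simp
  qed
  have dom: "dom (pl(e \<mapsto> z)) = dom pl" "e \<in> dom pl"
    using assms(2) by auto
  have "{e' \<in> dom pl - {e}. P (the ((pl(e \<mapsto> z)) e'))} = {e' \<in> dom pl - {e}. P (the (pl e'))}"
    by auto
  then show ?thesis
    using split[OF dom(2) assms(1), of "\<lambda>e. P (the (pl e))"]
      split[OF dom(2) assms(1), of "\<lambda>e'. P (the ((pl(e \<mapsto> z)) e'))"] assms(2)
    unfolding edge_count_def by (simp only: fst_conv dom(1)) simp
qed

text \<open>The root stays incident to the edge, so only the abandoned and the new endpoint are
  affected; the two changes cancel if the edge is put back.\<close>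

lemma deg_rewire:
  assumes "finite (dom pl)" "pl e = Some {r, o'}" "r \<noteq> o'" "r \<noteq> w"
  shows "real (deg (pl(e \<mapsto> {r, w}), op) x)
    = real (deg (pl, op) x) + of_bool (x = w) - of_bool (x = o')"
  using assms by (subst edge_count_upd[OF assms(1,2)]) (auto simp: of_bool_def)

lemma sum_deg:
  assumes "wf_state n s"
  shows "(\<Sum>v<n. deg s v) = 2 * card (dom (fst s))"
proof -
  have ran: "the (fst s e) \<subseteq> {..<n} \<and> card (the (fst s e)) = 2" if e: "e \<in> dom (fst s)" for e
  proof -
    have "the (fst s e) \<in> ran (fst s)"
      using e by (auto intro: ranI)
    then show ?thesis
      using assms by (auto simp: wf_state_def split: prod.splits)
  qed
  have fin: "finite (dom (fst s))"
    using assms by (auto simp: wf_state_def split: prod.splits)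
  have "(\<Sum>v<n. deg s v) = (\<Sum>v<n. \<Sum>e\<in>dom (fst s). of_bool (v \<in> the (fst s e)))"
    using fin by (simp add: edge_count_def Int_def)
  also have "\<dots> = (\<Sum>e\<in>dom (fst s). \<Sum>v<n. of_bool (v \<in> the (fst s e)))"
    by (rule sum.swap)
  also have "\<dots> = (\<Sum>e\<in>dom (fst s). 2)"
  proof (intro sum.cong refl)
    fix e assume "e \<in> dom (fst s)"
    then have "{..<n} \<inter> the (fst s e) = the (fst s e)" "card (the (fst s e)) = 2"
      using ran by auto
    then show "(\<Sum>v<n. of_bool (v \<in> the (fst s e))) = (2::nat)"
      by simp
  qed
  finally show ?thesis by simp
qed

section \<open>Opinion counts and the invariant of the chain\<close>

lemma opinion_count_leave:
  assumes "a < n" "op a = c"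
  shows "real (opinion_count n c (pl, op(a := (\<not> c)))) = real (opinion_count n c (pl, op)) - 1"
proof -
  have "{v \<in> {..<n}. op v = c} = insert a {v \<in> {..<n}. (op(a := (\<not> c))) v = c}"
    using assms by auto
  then show ?thesis
    by (simp add: opinion_count_def)
qed

lemma opinion_count_join:
  assumes "b < n" "op b = (\<not> c)"
  shows "real (opinion_count n c (pl, op(b := c))) = real (opinion_count n c (pl, op)) + 1"
proof -
  have "{v \<in> {..<n}. (op(b := c)) v = c} = insert b {v \<in> {..<n}. op v = c}"
    using assms by auto
  then show ?thesis
    using assms by (simp add: opinion_count_def)
qed

lemma opinion_count_complement:
  "opinion_count n c s + opinion_count n (\<not> c) s = n"
proof -
  obtain pl op where s: "s = (pl, op)" by (cases s)
  have "card {v \<in> {..<n}. op v = c} + card {v \<in> {..<n}. op v = (\<not> c)}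
      = card ({v \<in> {..<n}. op v = c} \<union> {v \<in> {..<n}. op v = (\<not> c)})"
    by (rule card_Un_disjoint[symmetric]) auto
  also have "{v \<in> {..<n}. op v = c} \<union> {v \<in> {..<n}. op v = (\<not> c)} = {..<n}"
    by auto
  finally show ?thesis
    by (simp add: opinion_count_def s)
qed

text \<open>The bound on the number of edges holds initially and persists because no step creates or
  deletes an edge; it caps both the degree sum and the number of edges between hubs.\<close>

definition rtr_inv :: "nat \<Rightarrow> state \<Rightarrow> bool" where
  "rtr_inv n s \<longleftrightarrow> wf_state n s \<and> 2 * card (dom (fst s)) \<le> n * n"

lemma rtr_step_cases:
  assumes wf: "wf_state n s" and s': "s' \<in> set_pmf (rtr_step \<beta> n s)"
  shows "dom (fst s') = dom (fst s) \<and>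
    \<bar>real (opinion_count n c s') - real (opinion_count n c s)\<bar> \<le> 1"
proof (cases "disagreeing s = {}")
  case True
  then show ?thesis
    using assms by (auto simp: rtr_step_def split: prod.splits)
next
  case False
  obtain pl op where s: "s = (pl, op)" by (cases s)
  note choices = rtr_step_choices[OF wf[unfolded s]]
  from s' obtain e u b where e: "e \<in> disagreeing (pl, op)" and u: "u \<in> set_pmf (pmf_of_set (the (pl e)))"
    and *: "s' \<in> set_pmf (if b then (let v = the_elem (the (pl e) - {u}) in return_pmf (pl, op(u := op v)))
       else do { v' \<leftarrow> pmf_of_set ({..<n} - {u}); return_pmf (pl(e \<mapsto> {u, v'}), op) })"
    using False choices(1) by (auto simp: rtr_step_def s)
  obtain a d where ad: "pl e = Some {a, d}" "op a \<noteq> op d"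
    using e by (auto simp: disagreeing_def)
  then have u': "u \<in> the (pl e)"
    using u by simp
  show ?thesis
  proof (cases b)
    case True
    obtain v where v: "v < n" "v \<noteq> u" "op v \<noteq> op u" "the (pl e) = {u, v}"
        "the_elem (the (pl e) - {u}) = v"
      using choices(2)[OF e u'] by blast
    have un: "u < n"
      using wf u' ad by (auto simp: s wf_state_def ran_def)
    have s': "s' = (pl, op(u := op v))"
      using * True v by simp
    show ?thesis
    proof (cases "op u = c")
      case True
      then have "op v = (\<not> c)" using v by auto
      then show ?thesis
        using opinion_count_leave[of u n op c pl] un True by (simp add: s' s)
    next
      case False
      then have "op v = c" "op u = (\<not> c)" using v by auto
      then show ?thesis
        using opinion_count_join[of u n op c pl] un by (simp add: s' s)
    qed
  next
    case False
    have "{..<n} - {u} \<noteq> {}"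
      using choices(2)[OF e u'] by auto
    then obtain v' where "s' = (pl(e \<mapsto> {u, v'}), op)"
      using * False by auto
    then show ?thesis
      using ad by (auto simp: s opinion_count_def)
  qed
qed

lemma rtr_inv_step: "rtr_inv n s \<Longrightarrow> s' \<in> set_pmf (rtr_step \<beta> n s) \<Longrightarrow> rtr_inv n s'"
  using wf_state_step[of n s s' \<beta>] rtr_step_cases[of n s s' \<beta>] by (auto simp: rtr_inv_def)

lemma rtr_inv_init:
  assumes "s \<in> set_pmf (rtr_init n)"
  shows "rtr_inv n s"
proof -
  let ?A = "{e. e \<subseteq> {..<n} \<and> card e = 2}"
  have fin: "finite ?A"
    by simp
  from assms obtain E op where E: "E \<in> set_pmf (erdos_renyi n (1/2))"
    and s: "s = (\<lambda>e. if e \<in> E then Some e else None, op)"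
    by (auto simp: rtr_init_def)
  have EA: "E \<subseteq> ?A"
    using E set_Pi_pmf_subset[OF fin, of False "\<lambda>_. bernoulli_pmf (1/2)"]
    by (auto simp: erdos_renyi_def)
  have "dom (fst s) = E"
    by (auto simp: s dom_def)
  moreover have "card E \<le> card ?A"
    using EA fin by (rule card_mono[rotated])
  moreover have "card ?A = n choose 2"
    using n_subsets[of "{..<n}" 2] by simp
  moreover have "2 * (n choose 2) \<le> n * n"
    unfolding choose_two by (rule le_trans[OF times_div_less_eq_dividend]) simp
  ultimately show ?thesis
    using wf_state_init[OF assms] by (simp add: rtr_inv_def)
qed

text \<open>A relabelling moves the count up or down with equal probability, so the square gains 1
  on average; rewiring leaves it alone.\<close>

lemma edge_mean_opinion_sq:
  fixes \<beta> :: real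
  assumes \<beta>: "0 < \<beta>" "\<beta> < n" and ab: "a < n" "b < n" "snd s a = c" "snd s b = (\<not> c)"
  shows "edge_mean \<beta> n (\<lambda>s. (real (opinion_count n c s) - m)\<^sup>2) s e a b
    \<le> (real (opinion_count n c s) - m)\<^sup>2 + \<beta> / n"
proof -
  obtain pl op where s: "s = (pl, op)" by (cases s)
  let ?F = "\<lambda>s. (real (opinion_count n c s) - m)\<^sup>2"
  let ?x = "real (opinion_count n c s) - m"
  have leave: "real (opinion_count n c (pl, op(a := op b))) = real (opinion_count n c s) - 1"
    using opinion_count_leave[of a n op c pl] ab by (simp only: s snd_conv)
  have join: "real (opinion_count n c (pl, op(b := op a))) = real (opinion_count n c s) + 1"
    using opinion_count_join[of b n op c pl] ab by (simp only: s snd_conv)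
  have stay: "opinion_count n c (pl', op) = opinion_count n c s" for pl'
    by (simp add: s opinion_count_def)
  have "edge_mean \<beta> n ?F (pl, op) e a b
      \<le> \<beta> / n * (((?x - 1)\<^sup>2 + (?x + 1)\<^sup>2) / 2)
        + (1 - \<beta> / n) * ((?x\<^sup>2 + ?x\<^sup>2) / 2 + (\<Sum>w<n. 0) / (real n - 1))"
  proof (rule edge_mean_le[OF \<beta> ab(1,2)])
    show "a \<noteq> b" using ab by auto
  qed (simp_all add: leave join stay algebra_simps)
  also have "k * (((x - 1)\<^sup>2 + (x + 1)\<^sup>2) / 2) + (1 - k) * ((x\<^sup>2 + x\<^sup>2) / 2 + (\<Sum>w<n. 0) / (real n - 1))
      = x\<^sup>2 + k" for k x :: real
    by (simp add: power2_eq_square field_simps)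
  finally show ?thesis
    by (simp add: s)
qed

text \<open>A rewiring multiplies the term of one uniformly chosen new endpoint by at most e, and
  the losses of degree are discarded. This yields the exponential moments that keep non-hubs from
  becoming hubs.\<close>

lemma edge_mean_exp_deg:
  fixes \<beta> :: real
  assumes \<beta>: "0 < \<beta>" "\<beta> < n" and wf: "wf_state n s" and e: "fst s e = Some {a, b}"
    and ab: "a < n" "b < n" "a \<noteq> b" and S: "S \<subseteq> {..<n}"
  shows "edge_mean \<beta> n (\<lambda>s. \<Sum>v\<in>S. exp (real (deg s v))) s e a b
    \<le> (1 + 2 / (real n - 1)) * (\<Sum>v\<in>S. exp (real (deg s v)))"
proof -
  obtain pl op where s: "s = (pl, op)" by (cases s)
  let ?F = "\<lambda>s. \<Sum>v\<in>S. exp (real (deg s v))"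
  \<comment> \<open>The factor 2 is an upper bound for e - 1.\<close>
  let ?G = "\<lambda>w. if w \<in> S then 2 * exp (real (deg s w)) else 0"
  have finS: "finite S"
    using S finite_subset by blast
  have fin: "finite (dom pl)"
    using wf by (simp add: s wf_state_def)
  have n: "real n - 1 > 0"
    using ab by linarith
  have rewire: "?F (pl(e \<mapsto> {r, w}), op) \<le> ?F s + ?G w"
    if "pl e = Some {r, q}" "r \<noteq> q" "w \<noteq> r" for r q w
  proof -
    have "?F (pl(e \<mapsto> {r, w}), op) \<le> (\<Sum>v\<in>S. exp (real (deg s v)) + (if v = w then ?G w else 0))"
    proof (rule sum_mono)
      fix v assume v: "v \<in> S"
      have d: "real (deg (pl(e \<mapsto> {r, w}), op) v) \<le> real (deg s v) + of_bool (v = w)"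
        using deg_rewire[OF fin that(1,2), of w op v] that by (simp add: s)
      show "exp (real (deg (pl(e \<mapsto> {r, w}), op) v)) \<le> exp (real (deg s v)) + (if v = w then ?G w else 0)"
      proof (cases "v = w")
        case True
        have "exp (real (deg (pl(e \<mapsto> {r, w}), op) v)) \<le> exp (real (deg s v) + 1)"
          using d True by simp
        also have "\<dots> = exp (real (deg s v)) * exp 1"
          by (rule exp_add)
        also have "\<dots> \<le> exp (real (deg s v)) * 3"
          by (intro mult_left_mono exp_le) simp
        finally show ?thesis
          using True v by simp
      qed (use d in simp)
    qed
    also have "\<dots> \<le> ?F s + ?G w"
      using finS by (simp add: sum.distrib)
    finally show ?thesis .
  qed
  have "edge_mean \<beta> n ?F (pl, op) e a b
    \<le> \<beta> / n * ((?F s + ?F s) / 2)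
      + (1 - \<beta> / n) * ((?F s + ?F s) / 2 + (\<Sum>w<n. ?G w) / (real n - 1))"
    using e ab \<beta> rewire[of a b] rewire[of b a]
    by (intro edge_mean_le) (auto simp: s insert_commute)
  also have "(\<Sum>w<n. ?G w) = 2 * ?F s"
    using S by (simp add: sum.If_cases Int_absorb1 sum_distrib_left)
  also have "\<beta> / n * ((?F s + ?F s) / 2) + (1 - \<beta> / n) * ((?F s + ?F s) / 2 + 2 * ?F s / (real n - 1))
      = ?F s + (1 - \<beta> / n) * (2 * ?F s / (real n - 1))"
    by (simp add: algebra_simps)
  also have "\<dots> \<le> ?F s + 1 * (2 * ?F s / (real n - 1))"
    using \<beta> n by (intro add_left_mono mult_right_mono) (auto intro!: divide_nonneg_pos sum_nonneg)
  also have "\<dots> = (1 + 2 / (real n - 1)) * ?F s"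
    by (simp add: algebra_simps)
  finally show ?thesis
    by (simp add: s)
qed

section \<open>The Lyapunov function\<close>

definition vertex_weight :: "nat set \<Rightarrow> real \<Rightarrow> real \<Rightarrow> state \<Rightarrow> nat \<Rightarrow> real" where
  "vertex_weight H h \<gamma> s v = (if v \<in> H then h else 1 - exp (- \<gamma> * deg s v))"

definition lyapunov :: "nat \<Rightarrow> bool \<Rightarrow> nat set \<Rightarrow> real \<Rightarrow> real \<Rightarrow> real \<Rightarrow> state \<Rightarrow> real" where
  "lyapunov n c H h \<gamma> k s = (\<Sum>v | v < n \<and> snd s v = c. vertex_weight H h \<gamma> s v)
     + k * edge_count s (\<lambda>y. y \<subseteq> H)"

lemma vertex_weight_bounds:
  "0 \<le> h \<Longrightarrow> h \<le> 1 \<Longrightarrow> 0 \<le> \<gamma> \<Longrightarrow> 0 \<le> vertex_weight H h \<gamma> s v \<and> vertex_weight H h \<gamma> s v \<le> 1"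
  by (simp add: vertex_weight_def)

lemma vertex_weight_upd_opinion [simp]:
  "vertex_weight H h \<gamma> (pl, op(u := c)) v = vertex_weight H h \<gamma> (pl, op) v"
  by (simp add: vertex_weight_def)

lemma lyapunov_leave:
  assumes "a < n" "op a = c"
  shows "lyapunov n c H h \<gamma> k (pl, op(a := (\<not> c)))
    = lyapunov n c H h \<gamma> k (pl, op) - vertex_weight H h \<gamma> (pl, op) a"
proof -
  have "{v. v < n \<and> op v = c} = insert a {v. v < n \<and> (op(a := (\<not> c))) v = c}"
    using assms by auto
  then show ?thesis
    by (simp add: lyapunov_def)
qed

lemma lyapunov_join:
  assumes "b < n" "op b = (\<not> c)"
  shows "lyapunov n c H h \<gamma> k (pl, op(b := c))
    = lyapunov n c H h \<gamma> k (pl, op) + vertex_weight H h \<gamma> (pl, op) b"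
proof -
  have "{v. v < n \<and> (op(b := c)) v = c} = insert b {v. v < n \<and> op v = c}"
    using assms by auto
  then show ?thesis
    using assms by (simp add: lyapunov_def)
qed

text \<open>Only the weights of \<open>q\<close> and \<open>w\<close> can change. By convexity of
  the exponential, one edge more adds at most \<gamma> to a weight, and one edge less at degree d
  removes at least \<gamma> exp(-\<gamma> d). The second, two-sided bound serves the quadratic term
  in the expansion of the exponential.\<close>

lemma lyapunov_rewire:
  fixes c :: bool and op :: "nat \<Rightarrow> bool" and H :: "nat set" and h \<gamma> k :: real
  assumes fin: "finite (dom pl)" and e: "pl e = Some {r, q}"
    and v: "r \<noteq> q" "w \<noteq> r" "r < n" "q < n" "w < n" and pos: "0 \<le> \<gamma>" "0 \<le> k"
  defines "\<Delta> \<equiv> lyapunov n c H h \<gamma> k (pl(e \<mapsto> {r, w}), op) - lyapunov n c H h \<gamma> k (pl, op)"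
  shows "\<Delta> \<le> \<gamma> * of_bool (op w = c) + k * of_bool (w \<in> H)
      - \<gamma> * exp (- \<gamma> * deg (pl, op) q) * of_bool (op q = c \<and> q \<notin> H) - k * of_bool (r \<in> H \<and> q \<in> H)"
    and "\<bar>\<Delta>\<bar> \<le> \<gamma> + k"
proof -
  let ?s = "(pl, op)" and ?s' = "(pl(e \<mapsto> {r, w}), op)"
  let ?W = "vertex_weight H h \<gamma>"
  let ?U = "{v. v < n \<and> op v = c}"
  have deg: "real (deg ?s' x) = real (deg ?s x) + of_bool (x = w) - of_bool (x = q)" for x
    using v by (intro deg_rewire[OF fin e]) auto
  have inner: "real (edge_count ?s' (\<lambda>y. y \<subseteq> H))
      = real (edge_count ?s (\<lambda>y. y \<subseteq> H)) + of_bool (r \<in> H \<and> w \<in> H) - of_bool (r \<in> H \<and> q \<in> H)"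
    using edge_count_upd[OF fin e, of "{r, w}" op "\<lambda>y. y \<subseteq> H"] by simp
  \<comment> \<open>Both \<open>g\<close> and \<open>l\<close> vanish for \<open>w = q\<close>,
    where the edge returns to its place and no degree changes.\<close>
  define g where "g = (if op w = c \<and> w \<notin> H \<and> w \<noteq> q
      then exp (- \<gamma> * deg ?s w) - exp (- \<gamma> * (deg ?s w + 1)) else 0)"
  define l where "l = (if op q = c \<and> q \<notin> H \<and> w \<noteq> q
      then exp (- \<gamma> * (real (deg ?s q) - 1)) - exp (- \<gamma> * deg ?s q) else 0)"
  have "(\<Sum>v\<in>?U. ?W ?s' v) - (\<Sum>v\<in>?U. ?W ?s v) = (\<Sum>v\<in>?U. (if v = w then g else 0) - (if v = q then l else 0))"
    unfolding sum_subtractf[symmetric]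
  proof (rule sum.cong[OF refl])
    fix v assume "v \<in> ?U"
    then show "?W ?s' v - ?W ?s v = (if v = w then g else 0) - (if v = q then l else 0)"
      using deg[of v] by (auto simp: vertex_weight_def g_def l_def of_nat_Suc)
  qed
  also have "\<dots> = g - l"
    using v by (auto simp: sum_subtractf g_def l_def)
  finally have \<Delta>: "\<Delta> = g - l + k * (of_bool (r \<in> H \<and> w \<in> H) - of_bool (r \<in> H \<and> q \<in> H))"
    unfolding \<Delta>_def lyapunov_def inner by (simp add: algebra_simps)
  have exp_diff: "exp (- \<gamma> * x) - exp (- \<gamma> * (x + 1)) \<le> \<gamma> * exp (- \<gamma> * x)"
    "exp (- \<gamma> * x) - exp (- \<gamma> * (x + 1)) \<ge> \<gamma> * exp (- \<gamma> * (x + 1))" for x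
  proof -
    have split: "exp (- \<gamma> * (x + 1)) = exp (- \<gamma> * x) * exp (- \<gamma>)"
      by (simp add: algebra_simps flip: exp_add)
    have "exp (- \<gamma> * x) * (1 - \<gamma>) \<le> exp (- \<gamma> * x) * exp (- \<gamma>)"
      using exp_ge_add_one_self[of "- \<gamma>"] by (intro mult_left_mono) auto
    then show "exp (- \<gamma> * x) - exp (- \<gamma> * (x + 1)) \<le> \<gamma> * exp (- \<gamma> * x)"
      unfolding split by (simp add: algebra_simps)
    have split': "exp (- \<gamma> * x) = exp (- \<gamma> * (x + 1)) * exp \<gamma>"
      by (simp add: algebra_simps flip: exp_add)
    have "exp (- \<gamma> * (x + 1)) * (1 + \<gamma>) \<le> exp (- \<gamma> * (x + 1)) * exp \<gamma>"
      using exp_ge_add_one_self[of "\<gamma>"] by (intro mult_left_mono) auto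
    then show "exp (- \<gamma> * x) - exp (- \<gamma> * (x + 1)) \<ge> \<gamma> * exp (- \<gamma> * (x + 1))"
      unfolding split' by (simp add: algebra_simps)
  qed
  have exp_le: "\<gamma> * exp (- \<gamma> * x) \<le> \<gamma>" if "0 \<le> x" for x
    using that pos by (intro mult_left_le) auto
  have g: "0 \<le> g" "g \<le> \<gamma>" "w = q \<Longrightarrow> g = 0" "op w \<noteq> c \<Longrightarrow> g = 0"
    using exp_diff[of "deg ?s w"] exp_le[of "deg ?s w"] pos
    by (auto simp: g_def add.commute[of 1] intro: order_trans[OF exp_diff(1)] order_trans[OF _ exp_diff(2)]
      mult_left_mono)
  \<comment> \<open>The exponent of \<open>l\<close> is at degree minus one, which must be
    nonnegative before it can be compared with \<gamma>.\<close>
  have "1 \<le> real (deg ?s q)" if "w \<noteq> q"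
    using deg[of q] that by simp
  then have l: "l \<le> \<gamma>" "0 \<le> l" "w = q \<Longrightarrow> l = 0"
      "w \<noteq> q \<Longrightarrow> op q = c \<Longrightarrow> q \<notin> H \<Longrightarrow> \<gamma> * exp (- \<gamma> * deg ?s q) \<le> l"
      "\<not> (op q = c \<and> q \<notin> H) \<Longrightarrow> l = 0"
    using exp_diff[of "real (deg ?s q) - 1"] exp_le[of "real (deg ?s q) - 1"] pos
      exp_le[of "deg ?s q"]
    by (auto simp: l_def intro: mult_left_mono)
  have gl: "g - l \<le> \<gamma> * of_bool (op w = c)
      - \<gamma> * exp (- \<gamma> * deg ?s q) * of_bool (op q = c \<and> q \<notin> H)"
  proof (cases "w = q")
    case True
    then show ?thesis
      using g l exp_le[of "deg ?s q"] by auto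
  next
    case False
    then show ?thesis
      using g l pos by (cases "op w = c"; cases "op q = c \<and> q \<notin> H") auto
  qed
  have kk: "k * of_bool (r \<in> H \<and> w \<in> H) \<le> k * of_bool (w \<in> H)"
    using pos by (intro mult_left_mono) auto
  show "\<Delta> \<le> \<gamma> * of_bool (op w = c) + k * of_bool (w \<in> H)
      - \<gamma> * exp (- \<gamma> * deg (pl, op) q) * of_bool (op q = c \<and> q \<notin> H) - k * of_bool (r \<in> H \<and> q \<in> H)"
    using gl kk unfolding \<Delta> right_diff_distrib by linarith
  have "\<bar>g - l\<bar> \<le> \<gamma>"
    using g l by linarith
  moreover have "\<bar>k * (of_bool (r \<in> H \<and> w \<in> H) - of_bool (r \<in> H \<and> q \<in> H))\<bar> \<le> k"
    using pos by (auto simp: of_bool_def)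
  ultimately show "\<bar>\<Delta>\<bar> \<le> \<gamma> + k"
    unfolding \<Delta> by linarith
qed

section \<open>Exponential drift of the Lyapunov function\<close>

lemma exp_le_quadratic:
  fixes x :: real
  assumes "\<bar>x\<bar> \<le> 1"
  shows "exp x \<le> 1 + x + x\<^sup>2"
proof (cases "0 \<le> x")
  case True
  then show ?thesis
    using exp_bound[of x] assms by auto
next
  case False
  define y where "y = - x"
  have y: "0 \<le> y"
    using False by (simp add: y_def)
  \<comment> \<open>The product expands to 1 + (y^2 + y^3 + y^4) / 2, and its first factor is a
    lower bound for exp y.\<close>
  have "1 \<le> (1 + y + y\<^sup>2 / 2) * (1 - y + y\<^sup>2)"
    using y mult_nonneg_nonneg[OF y y] mult_nonneg_nonneg[OF y mult_nonneg_nonneg[OF y y]]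
      mult_nonneg_nonneg[OF y mult_nonneg_nonneg[OF y mult_nonneg_nonneg[OF y y]]]
    by (simp add: power2_eq_square field_simps)
  also have "\<dots> \<le> exp y * (1 - y + y\<^sup>2)"
    using y exp_lower_Taylor_quadratic[OF y] zero_le_square[of "y - 1/2"]
    by (intro mult_right_mono) (auto simp: power2_eq_square algebra_simps)
  finally have "exp (- y) * 1 \<le> exp (- y) * (exp y * (1 - y + y\<^sup>2))"
    by (intro mult_left_mono) auto
  then show ?thesis
    by (simp add: y_def mult.assoc[symmetric] flip: exp_add)
qed

text \<open>\<open>D\<close> bounds the linear drift for the given edge. Only the root
  \<open>b\<close> makes \<open>a\<close> lose an edge, whence the half in its second line; a degree
  loss of \<open>b\<close> is invisible since \<open>b\<close> has the other opinion. In the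
  quadratic term, a relabelling of probability \<beta>/n changes the function by at most 1, and a
  rewiring by at most \<gamma> + k. Working with the exponential makes the probability of late
  survival exponentially small.\<close>

lemma edge_mean_exp_lyapunov:
  fixes \<beta> \<theta> \<gamma> k h :: real and H :: "nat set" and c :: bool
  assumes \<beta>: "0 < \<beta>" "\<beta> < n" and wf: "wf_state n s" and e: "fst s e = Some {a, b}"
    and ab: "a < n" "b < n" "snd s a = c" "snd s b = (\<not> c)" and H: "H \<subseteq> {..<n}"
    and pos: "0 \<le> \<gamma>" "0 \<le> k" "\<gamma> + k \<le> 1" "0 \<le> h" "h \<le> 1" "0 \<le> \<theta>" "\<theta> \<le> 1"
  defines "F \<equiv> \<lambda>s. exp (\<theta> * lyapunov n c H h \<gamma> k s)"
  defines "D \<equiv> \<beta> / n * ((vertex_weight H h \<gamma> s b - vertex_weight H h \<gamma> s a) / 2)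
    + (1 - \<beta> / n) * (- \<gamma> * exp (- \<gamma> * deg s a) * of_bool (a \<notin> H) / 2
        - k * of_bool (a \<in> H \<and> b \<in> H) + (\<gamma> * opinion_count n c s + k * card H) / (real n - 1))"
  shows "edge_mean \<beta> n F s e a b \<le> F s * (1 + \<theta> * D + \<theta>\<^sup>2 * (\<beta> / n + (\<gamma> + k)\<^sup>2))"
proof -
  obtain pl op where s: "s = (pl, op)" by (cases s)
  let ?W = "vertex_weight H h \<gamma> s"
  let ?L = "lyapunov n c H h \<gamma> k"
  have fin: "finite (dom pl)"
    using wf by (simp add: s wf_state_def)
  have ne: "a \<noteq> b"
    using ab by auto
  have W: "0 \<le> ?W v" "?W v \<le> 1" for v
    using vertex_weight_bounds[of h \<gamma> H s v] pos by auto
  have Fle: "F s' \<le> F s * (1 + \<theta> * d + \<theta>\<^sup>2 * z)"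
    if d: "?L s' - ?L s \<le> d" and z: "(?L s' - ?L s)\<^sup>2 \<le> z" and le: "\<bar>?L s' - ?L s\<bar> \<le> 1" for s' d z
  proof -
    let ?x = "\<theta> * (?L s' - ?L s)"
    have "\<bar>?x\<bar> \<le> 1"
      using mult_mono[OF pos(7) le] pos by (simp add: abs_mult)
    then have "exp ?x \<le> 1 + ?x + ?x\<^sup>2"
      by (rule exp_le_quadratic)
    also have "\<dots> \<le> 1 + \<theta> * d + \<theta>\<^sup>2 * z"
      unfolding power_mult_distrib using d z pos by (intro add_mono mult_left_mono) auto
    finally have "F s * exp ?x \<le> F s * (1 + \<theta> * d + \<theta>\<^sup>2 * z)"
      by (intro mult_left_mono) (auto simp: F_def)
    moreover have "F s' = F s * exp ?x"
      by (simp add: F_def right_diff_distrib flip: exp_add)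
    ultimately show ?thesis by simp
  qed
  have leave: "F (pl, op(a := op b)) \<le> F s * (1 + \<theta> * (- ?W a) + \<theta>\<^sup>2 * 1)"
  proof -
    have "?L (pl, op(a := op b)) = ?L s - ?W a"
      using lyapunov_leave[of a n op c] ab by (simp only: s snd_conv)
    then show ?thesis
      using W[of a] by (intro Fle) (auto simp: power_le_one)
  qed
  have join: "F (pl, op(b := op a)) \<le> F s * (1 + \<theta> * ?W b + \<theta>\<^sup>2 * 1)"
  proof -
    have "?L (pl, op(b := op a)) = ?L s + ?W b"
      using lyapunov_join[of b n op c] ab by (simp only: s snd_conv)
    then show ?thesis
      using W[of b] by (intro Fle) (auto simp: power_le_one)
  qed
  let ?h = "k * of_bool (a \<in> H \<and> b \<in> H)"
  let ?l = "\<gamma> * exp (- \<gamma> * deg s a) * of_bool (a \<notin> H)"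
  let ?g = "\<lambda>w. \<gamma> * of_bool (op w = c) + k * of_bool (w \<in> H)"
  have rewire: "F (pl(e \<mapsto> {r, w}), op)
      \<le> F s * (1 + \<theta> * (- \<gamma> * exp (- \<gamma> * deg s q) * of_bool (op q = c \<and> q \<notin> H)
          - k * of_bool (r \<in> H \<and> q \<in> H)) + \<theta>\<^sup>2 * (\<gamma> + k)\<^sup>2) + F s * \<theta> * ?g w"
    if "pl e = Some {r, q}" "r \<noteq> q" "w \<noteq> r" "r < n" "q < n" "w < n" for r q w
  proof -
    note L = lyapunov_rewire[OF fin that pos(1,2), of c H h op, folded s]
    have "F (pl(e \<mapsto> {r, w}), op) \<le> F s * (1 + \<theta> * (?g w
        - \<gamma> * exp (- \<gamma> * deg s q) * of_bool (op q = c \<and> q \<notin> H) - k * of_bool (r \<in> H \<and> q \<in> H))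
        + \<theta>\<^sup>2 * (\<gamma> + k)\<^sup>2)"
      by (rule Fle) (use L pos in \<open>auto simp: abs_le_square_iff[symmetric]\<close>)
    then show ?thesis
      by (simp add: algebra_simps)
  qed
  have "edge_mean \<beta> n F (pl, op) e a b
    \<le> \<beta> / n * ((F s * (1 + \<theta> * (- ?W a) + \<theta>\<^sup>2 * 1) + F s * (1 + \<theta> * ?W b + \<theta>\<^sup>2 * 1)) / 2)
      + (1 - \<beta> / n) * ((F s * (1 + \<theta> * (- ?h) + \<theta>\<^sup>2 * (\<gamma> + k)\<^sup>2)
          + F s * (1 + \<theta> * (- ?l - ?h) + \<theta>\<^sup>2 * (\<gamma> + k)\<^sup>2)) / 2
          + (\<Sum>w<n. F s * \<theta> * ?g w) / (real n - 1))"
  proof (rule edge_mean_le[OF \<beta> ab(1,2) ne leave join])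
    show "F (pl(e \<mapsto> {a, w}), op) \<le> F s * (1 + \<theta> * (- ?h) + \<theta>\<^sup>2 * (\<gamma> + k)\<^sup>2) + F s * \<theta> * ?g w"
      if "w < n" "w \<noteq> a" for w
      using rewire[of a b w] that e ab ne by (simp add: s)
    show "F (pl(e \<mapsto> {b, w}), op) \<le> F s * (1 + \<theta> * (- ?l - ?h) + \<theta>\<^sup>2 * (\<gamma> + k)\<^sup>2) + F s * \<theta> * ?g w"
      if "w < n" "w \<noteq> b" for w
      using rewire[of b a w] that e ab ne by (simp add: s insert_commute conj_commute)
    show "0 \<le> F s * \<theta> * ?g w" for w
      using pos by (auto simp: F_def)
  qed
  also have "(\<Sum>w<n. F s * \<theta> * ?g w) = F s * \<theta> * (\<gamma> * opinion_count n c s + k * card H)"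
  proof -
    have "{w. w < n \<and> w \<in> H} = H"
      using H by auto
    then show ?thesis
      by (simp add: sum_distrib_left[symmetric] sum.distrib s opinion_count_def Int_def lessThan_def)
  qed
  also have "\<beta> / n * ((F s * (1 + \<theta> * (- ?W a) + \<theta>\<^sup>2 * 1) + F s * (1 + \<theta> * ?W b + \<theta>\<^sup>2 * 1)) / 2)
      + (1 - \<beta> / n) * ((F s * (1 + \<theta> * (- ?h) + \<theta>\<^sup>2 * (\<gamma> + k)\<^sup>2)
          + F s * (1 + \<theta> * (- ?l - ?h) + \<theta>\<^sup>2 * (\<gamma> + k)\<^sup>2)) / 2
          + F s * \<theta> * (\<gamma> * opinion_count n c s + k * card H) / (real n - 1))
      = F s * (1 + \<theta> * D + \<theta>\<^sup>2 * (\<beta> / n + (1 - \<beta> / n) * (\<gamma> + k)\<^sup>2))"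
  proof -
    have "x * ((f * (1 + \<theta> * (- wa) + t) + f * (1 + \<theta> * wb + t)) / 2)
        + (1 - x) * ((f * (1 + \<theta> * (- h) + t * g) + f * (1 + \<theta> * (- l - h) + t * g)) / 2 + f * \<theta> * m)
      = f * (1 + \<theta> * (x * ((wb - wa) / 2) + (1 - x) * (- l / 2 - h + m)) + t * (x + (1 - x) * g))"
      for x f wa wb t h g l m :: real
      by (simp add: field_simps)
    from this[of "\<beta> / n" "F s" "?W a" "\<theta>\<^sup>2" "?W b" ?h "(\<gamma> + k)\<^sup>2" ?l
        "(\<gamma> * opinion_count n c s + k * card H) / (real n - 1)"]
    show ?thesis
      unfolding D_def by simp
  qed
  also have "\<dots> \<le> F s * (1 + \<theta> * D + \<theta>\<^sup>2 * (\<beta> / n + 1 * (\<gamma> + k)\<^sup>2))"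
    using \<beta> by (intro mult_left_mono add_left_mono mult_right_mono) (auto simp: F_def)
  finally show ?thesis
    by (simp add: s)
qed

text \<open>This is subcriticality. The choice of \<gamma> makes (1 - \<beta>/n) \<gamma> =
  \<beta>/n, so for a non-hub \<open>a\<close> the losses by relabelling and by rewiring, 1 -
  exp(-\<gamma> d) and exp(-\<gamma> d), add up to exactly 1, against a gain equal to the weight of
  \<open>b\<close>, which is below 1. The weight 1 - \<delta>/2 of hubs lies halfway between 1 and
  the bound 1 - \<delta> for non-hubs.\<close>

lemma edge_mean_exp_lyapunov_le:
  fixes \<beta> :: real and H :: "nat set" and c :: bool
  defines "\<delta> \<equiv> exp (- 82 * \<beta>)"
  assumes \<beta>: "0 < \<beta>" "9 * \<beta> \<le> n" "2 \<le> n" and wf: "wf_state n s" and e: "fst s e = Some {a, b}"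
    and ab: "a < n" "b < n" "snd s a = c" "snd s b = (\<not> c)"
    and H: "H \<subseteq> {..<n}" "8 * card H \<le> n"
    and deg: "\<And>v. v < n \<Longrightarrow> v \<notin> H \<Longrightarrow> deg s v \<le> 41 * n"
    and N: "real (opinion_count n c s) \<le> \<delta> / 64 * n"
  defines "F \<equiv> \<lambda>s. exp (\<delta> / 64 * lyapunov n c H (1 - \<delta> / 2) (\<beta> / (n - \<beta>)) (\<beta> * \<delta> / 4 / n) s)"
  shows "edge_mean \<beta> n F s e a b \<le> (1 - \<beta> * \<delta>\<^sup>2 / (2048 * real n)) * F s"
proof -
  define x where "x = \<beta> / n"
  define \<gamma> where "\<gamma> = \<beta> / (n - \<beta>)"
  define k where "k = \<beta> * \<delta> / 4 / n"
  define \<theta> where "\<theta> = \<delta> / 64"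
  let ?W = "vertex_weight H (1 - \<delta> / 2) \<gamma> s"
  have n: "\<beta> < n" "real n - \<beta> > 0" "real n - 1 > 0" "real n \<le> 2 * (real n - 1)"
    using \<beta> by auto
  have \<delta>: "0 < \<delta>" "\<delta> \<le> 1"
    using \<beta> by (auto simp: \<delta>_def)
  have x: "0 < x" "x \<le> 1 / 9"
    using \<beta> by (auto simp: x_def field_simps)
  have \<gamma>x: "(1 - x) * \<gamma> = x"
    using n \<beta> by (simp add: x_def \<gamma>_def field_simps)
  have \<gamma>0: "0 \<le> \<gamma>"
    using n \<beta> by (simp add: \<gamma>_def)
  have \<gamma>: "0 \<le> \<gamma>" "\<gamma> \<le> 9 / 8 * x"
    using \<gamma>x mult_right_mono[OF x(2) \<gamma>0] \<gamma>0 by (auto simp: algebra_simps)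
  have kx: "k = x * \<delta> / 4"
    by (simp add: k_def x_def)
  have k: "0 \<le> k" "k \<le> x / 4"
    using x \<delta> mult_left_mono[OF \<delta>(2), of x] by (auto simp: kx)
  have exp_ge: "\<delta> \<le> exp (- \<gamma> * deg s v)" if "v < n" "v \<notin> H" for v
  proof -
    have "\<gamma> * deg s v \<le> \<gamma> * (41 * n)"
      using deg[OF that] \<gamma>0 by (intro mult_left_mono) (auto simp flip: of_nat_mult intro: of_nat_mono)
    also have "\<dots> \<le> 82 * \<beta>"
      using n \<beta> mult_left_mono[OF \<beta>(2), of "\<beta>"] by (simp add: \<gamma>_def field_simps)
    finally show ?thesis
      by (simp add: \<delta>_def)
  qed
  define D where "D = x * ((?W b - ?W a) / 2)
    + (1 - x) * (- \<gamma> * exp (- \<gamma> * deg s a) * of_bool (a \<notin> H) / 2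
        - k * of_bool (a \<in> H \<and> b \<in> H) + (\<gamma> * opinion_count n c s + k * card H) / (real n - 1))"
  have "edge_mean \<beta> n F s e a b \<le> F s * (1 + \<theta> * D + \<theta>\<^sup>2 * (x + (\<gamma> + k)\<^sup>2))"
    unfolding F_def D_def \<theta>_def x_def \<gamma>_def[symmetric] k_def[symmetric]
    by (rule edge_mean_exp_lyapunov) (use \<beta>(1) n(1) wf e ab H(1) \<gamma> k x \<delta> in auto)
  also have "1 + \<theta> * D + \<theta>\<^sup>2 * (x + (\<gamma> + k)\<^sup>2) \<le> 1 - \<beta> * \<delta>\<^sup>2 / (2048 * real n)"
  proof -
    let ?E = "exp (- \<gamma> * deg s a) * of_bool (a \<notin> H)"
    let ?N = "opinion_count n c s / (real n - 1)" and ?C = "card H / (real n - 1)"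
    let ?j = "of_bool (a \<in> H \<and> b \<in> H) :: real"
    have N': "?N \<le> \<delta> / 32"
    proof -
      have "real (opinion_count n c s) \<le> \<delta> / 64 * (2 * (real n - 1))"
        by (rule order_trans[OF N]) (use n \<delta> in \<open>intro mult_left_mono; simp\<close>)
      then show ?thesis
        using n by (simp add: field_simps)
    qed
    \<comment> \<open>A rewiring ends at a hub with probability at most about 1/4, whereas a chosen
      edge between hubs is certain to be taken away from its pair.\<close>
    have C': "?C \<le> 1 / 4"
      using H(2) n by (simp add: field_simps)
    have "D = x * ((?W b - ?W a) / 2) - ((1 - x) * \<gamma>) * (?E / 2) - (1 - x) * k * ?j
        + ((1 - x) * \<gamma>) * ?N + (1 - x) * k * ?C"
      by (simp add: D_def algebra_simps add_divide_distrib diff_divide_distrib)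
    also have "\<dots> = x * ((?W b - ?W a - ?E) / 2 + ?N) + (1 - x) * k * (?C - ?j)"
      unfolding \<gamma>x by (simp add: field_simps)
    also have "\<dots> \<le> x * ((?W b - ?W a - ?E) / 2 + \<delta> / 32) + (1 - x) * k * (1 / 4 - ?j)"
      using N' C' x k by (intro add_mono mult_left_mono diff_mono) auto
    also have "\<dots> \<le> - x * \<delta> / 16"
    proof (cases "a \<in> H \<and> b \<in> H")
      \<comment> \<open>Between hubs the weights cancel, and only the expected loss of edges inside
        \<open>H\<close> gives negative drift.\<close>
      case True
      have "8 / 9 * k \<le> (1 - x) * k"
        using x k by (intro mult_right_mono) auto
      moreover have "0 \<le> x * \<delta>"
        using x \<delta> by simp
      ultimately have "x * \<delta> / 32 - 3 / 4 * ((1 - x) * k) \<le> - (x * \<delta>) / 16"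
        using kx by argo
      then show ?thesis
        using True by (simp add: vertex_weight_def)
    next
      case False
      \<comment> \<open>If \<open>a\<close> is no hub, the left side is the weight of
        \<open>b\<close> minus 1; if \<open>a\<close> is a hub, then \<open>b\<close> is none and
        weighs at most 1 - \<delta>.\<close>
      have "?W b - ?W a - ?E \<le> - \<delta> / 2"
        using False exp_ge[of b] exp_ge[of a] ab \<delta> by (auto simp: vertex_weight_def)
      then have "(?W b - ?W a - ?E) / 2 + \<delta> / 32 \<le> - (7 * \<delta> / 32)"
        by argo
      then have "x * ((?W b - ?W a - ?E) / 2 + \<delta> / 32) \<le> x * - (7 * \<delta> / 32)"
        using x by (intro mult_left_mono) auto
      moreover have "x * - (7 * \<delta> / 32) = - 7 / 32 * (x * \<delta>)"
        by simp
      moreover have "(1 - x) * k * (1 / 4 - ?j) \<le> 1 * k * (1 / 4)"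
        using x k False by (intro mult_mono) auto
      moreover have "0 \<le> x * \<delta>"
        using x \<delta> by simp
      ultimately show ?thesis
        using kx by argo
    qed
    finally have D: "D \<le> - x * \<delta> / 16" .
    have "(\<gamma> + k)\<^sup>2 \<le> (2 * x)\<^sup>2"
      using \<gamma> k x by (intro power_mono) auto
    also have "\<dots> = (4 * x) * x"
      by (simp add: power2_eq_square)
    also have "\<dots> \<le> 1 * x"
      using x by (intro mult_right_mono) auto
    finally have sq: "x + (\<gamma> + k)\<^sup>2 \<le> 2 * x"
      by simp
    \<comment> \<open>The value \<theta> = \<delta>/64 minimises - \<theta> x \<delta> / 16 + 2 x
      \<theta>^2.\<close>
    have "\<theta> * D + \<theta>\<^sup>2 * (x + (\<gamma> + k)\<^sup>2) \<le> \<theta> * (- x * \<delta> / 16) + \<theta>\<^sup>2 * (2 * x)"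
      using D sq \<delta> by (intro add_mono mult_left_mono) (auto simp: \<theta>_def)
    also have "\<dots> = - \<beta> * \<delta>\<^sup>2 / (2048 * real n)"
      using n \<beta> by (simp add: \<theta>_def x_def power2_eq_square field_simps)
    finally show ?thesis
      by simp
  qed
  then have "F s * (1 + \<theta> * D + \<theta>\<^sup>2 * (x + (\<gamma> + k)\<^sup>2)) \<le> F s * (1 - \<beta> * \<delta>\<^sup>2 / (2048 * real n))"
    by (intro mult_left_mono) (auto simp: F_def)
  finally show ?thesis
    by (simp add: mult.commute)
qed

section \<open>Size of the potential and number of hubs\<close>

lemma one_plus_power_le_exp:
  fixes x :: real
  assumes "-1 \<le> x"
  shows "(1 + x) ^ m \<le> exp (x * m)"
proof -
  have "(1 + x) ^ m \<le> exp x ^ m"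
    using assms by (intro power_mono exp_ge_add_one_self) auto
  then show ?thesis
    by (simp add: exp_of_nat2_mult)
qed

lemma lyapunov_bounds:
  fixes h \<gamma> k :: real
  assumes "0 \<le> h" "h \<le> 1" "0 \<le> \<gamma>" "0 \<le> k" "finite (dom (fst s))"
  shows "0 \<le> lyapunov n c H h \<gamma> k s"
    and "lyapunov n c H h \<gamma> k s \<le> opinion_count n c s + k * card (dom (fst s))"
proof -
  have W: "0 \<le> vertex_weight H h \<gamma> s v" "vertex_weight H h \<gamma> s v \<le> 1" for v
    using vertex_weight_bounds[of h \<gamma> H s v] assms by auto
  show "0 \<le> lyapunov n c H h \<gamma> k s"
    using W assms unfolding lyapunov_def by (intro add_nonneg_nonneg sum_nonneg mult_nonneg_nonneg) auto
  have "(\<Sum>v | v < n \<and> snd s v = c. vertex_weight H h \<gamma> s v) \<le> (\<Sum>v | v < n \<and> snd s v = c. 1)"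
    using W by (intro sum_mono) auto
  also have "\<dots> = opinion_count n c s"
    by (simp add: opinion_count_def split: prod.splits)
  finally have "(\<Sum>v | v < n \<and> snd s v = c. vertex_weight H h \<gamma> s v) \<le> opinion_count n c s" .
  moreover have "edge_count s (\<lambda>y. y \<subseteq> H) \<le> card (dom (fst s))"
    using assms(5) unfolding edge_count_def by (intro card_mono) auto
  then have "k * edge_count s (\<lambda>y. y \<subseteq> H) \<le> k * card (dom (fst s))"
    using assms(4) by (intro mult_left_mono) auto
  ultimately show "lyapunov n c H h \<gamma> k s \<le> opinion_count n c s + k * card (dom (fst s))"
    by (simp add: lyapunov_def)
qed

lemma card_high_degree_le:
  assumes "rtr_inv n s"
  shows "l * card {v. v < n \<and> l * n < deg s v} \<le> n"
proof (cases "n = 0")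
  case False
  let ?H = "{v. v < n \<and> l * n < deg s v}"
  have "(l * n) * card ?H \<le> (\<Sum>v\<in>?H. deg s v)"
    using sum_bounded_below[of ?H "l * n" "deg s"] by (simp add: mult.commute)
  also have "\<dots> \<le> (\<Sum>v<n. deg s v)"
    by (intro sum_mono2) auto
  also have "\<dots> \<le> n * n"
    using assms sum_deg[of n s] by (simp add: rtr_inv_def)
  finally show ?thesis
    using False by (simp add: ac_simps)
qed simp

section \<open>Termination\<close>

text \<open>
  The constants: \<open>H\<close> is the set of hubs at the start of a window of \<open>T = 8 n\<^sup>2\<close> steps. A vertex gains
  an edge with probability at most \<open>1 / (n - 1)\<close> per step, so a union bound over exponential moments
  keeps the degree of all other vertices below \<open>41 n = (8 + 32 + 1) n\<close> during the window; \<open>\<delta>\<close>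
  is a lower bound for \<open>exp (- \<gamma> d)\<close> at such degrees. The three summands of \<open>V\<close> control the
  fluctuation of the minority, these degrees, and the survival of disagreement.
\<close>

lemma miss_small_minority:
  fixes \<beta> \<epsilon> :: real
  defines "\<delta> \<equiv> exp (- 82 * \<beta>)"
  assumes \<beta>: "0 < \<beta>" "9 * \<beta> \<le> n" "2 \<le> n"
    and \<epsilon>: "0 < \<epsilon>" "\<epsilon> \<le> \<delta> / 128" "\<epsilon> \<le> \<beta> * \<delta> / 16" "4 \<le> \<epsilon> * n"
    and s0: "rtr_inv n s0" "\<epsilon> * n - 1 < minority_count n s0" "minority_count n s0 \<le> \<epsilon> * n"
    and t: "8 * n\<^sup>2 \<le> t"
  shows "miss (\<lambda>s. real (minority_count n s) \<le> \<epsilon> / 2 * n) (\<lambda>s. disagreeing s = {}) (rtr_step \<beta> n) t s0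
    \<le> 128 * \<beta> / (\<epsilon>\<^sup>2 * n) + n * exp (- real n) + exp (- \<beta> * \<delta>\<^sup>2 * n / 1024)"
proof -
  let ?A = "\<lambda>s. real (minority_count n s) \<le> \<epsilon> / 2 * n"
  let ?B = "\<lambda>s. disagreeing s = {}"
  let ?E = "\<lambda>s. measure_pmf.expectation (rtr_step \<beta> n s)"
  have \<delta>: "0 < \<delta>" "\<delta> \<le> 1"
    using \<beta> by (auto simp: \<delta>_def)
  have n: "0 < real n" "0 < real n - 1" "real n \<le> 2 * (real n - 1)" "\<beta> < n"
    using \<beta> by auto
  have "\<exists>c. minority_count n s0 = opinion_count n c s0"
    by (auto simp: minority_count_def min_def)
  then obtain c where c: "minority_count n s0 = opinion_count n c s0" ..
  define m where "m = real (opinion_count n c s0)"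
  define H where "H = {v. v < n \<and> 8 * n < deg s0 v}"
  define T where "T = 8 * n\<^sup>2"
  define \<rho> where "\<rho> = 1 + 2 / (real n - 1)"
  define q where "q = \<beta> * \<delta>\<^sup>2 / (2048 * real n)"
  \<comment> \<open>Normalised so that a fluctuation of \<epsilon> n / 4 makes the first summand of
    \<open>V\<close> reach 1.\<close>
  define d where "d = 16 / (\<epsilon> * n)\<^sup>2"
  define f where "f s = (real (opinion_count n c s) - m)\<^sup>2" for s
  define g where "g s = (\<Sum>v\<in>{..<n} - H. exp (real (deg s v)))" for s
  define L where "L = lyapunov n c H (1 - \<delta> / 2) (\<beta> / (n - \<beta>)) (\<beta> * \<delta> / 4 / n)"
  define F where "F s = exp (\<delta> / 64 * L s)" for s
  \<comment> \<open>Each summand includes the growth or decay bound for the remaining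
    \<open>T - k\<close> steps, so it does not increase on average. A large fluctuation or a non-hub
    degree above 41 n pushes \<open>V\<close> to 1.\<close>
  define V where "V k s = (f s + real (T - k) * (\<beta> / n)) * d + exp (- 41 * real n) * \<rho> ^ (T - k) * g s
    + (1 - q) ^ (T - k) * F s" for k s
  have q: "0 \<le> q" "q \<le> 1"
  proof -
    have "\<beta> * \<delta>\<^sup>2 \<le> real n * 1"
      using \<beta> \<delta> n by (intro mult_mono power_le_one) auto
    then show "0 \<le> q" "q \<le> 1"
      using \<beta> n by (auto simp: q_def)
  qed
  have \<rho>: "1 \<le> \<rho>"
    using n by (simp add: \<rho>_def)
  have d: "0 < d"
    using \<epsilon> n by (simp add: d_def)
  have g0: "0 \<le> g s" for s
    by (auto simp: g_def intro: sum_nonneg)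
  have L: "0 \<le> L s" "L s \<le> opinion_count n c s + \<beta> * \<delta> / 4 / n * card (dom (fst s))" if "rtr_inv n s" for s
  proof -
    have fin: "finite (dom (fst s))"
      using that by (auto simp: rtr_inv_def wf_state_def split: prod.splits)
    show "0 \<le> L s" "L s \<le> opinion_count n c s + \<beta> * \<delta> / 4 / n * card (dom (fst s))"
      unfolding L_def by (rule lyapunov_bounds; use \<beta> \<delta> n fin in auto)+
  qed
  have F1: "1 \<le> F s" if "rtr_inv n s" for s
    using L[OF that] \<delta> by (simp add: F_def)
  have parts: "0 \<le> (f s + real (T - k) * (\<beta> / n)) * d \<and> 0 \<le> exp (- 41 * real n) * \<rho> ^ (T - k) * g s \<and>
    0 \<le> (1 - q) ^ (T - k) * F s" for s k
    using \<beta> d \<rho> g0[of s] q by (auto simp: f_def F_def)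
  have H: "H \<subseteq> {..<n}" "8 * card H \<le> n"
    using card_high_degree_le[OF s0(1), of 8] by (auto simp: H_def)
  have fd: "f s * d \<le> V k s" for k s
  proof -
    have "f s * d \<le> (f s + real (T - k) * (\<beta> / n)) * d"
      using \<beta> d by (intro mult_right_mono) auto
    then show ?thesis
      using parts[of s k] by (simp add: V_def)
  qed
  have far: "1 \<le> f s * d" if "\<epsilon> * n / 4 \<le> \<bar>real (opinion_count n c s) - m\<bar>" for s
  proof -
    have "(\<epsilon> * n / 4)\<^sup>2 \<le> f s"
      unfolding f_def using that \<epsilon> n by (subst abs_le_square_iff[symmetric]) auto
    then have "(\<epsilon> * n / 4)\<^sup>2 * d \<le> f s * d"
      using d by (intro mult_right_mono) auto
    moreover have "(\<epsilon> * n / 4)\<^sup>2 * d = 1"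
      using \<epsilon> n by (simp add: d_def power2_eq_square)
    ultimately show ?thesis
      by simp
  qed
  have mm: "\<epsilon> * n - 1 < m" "m \<le> \<epsilon> * n"
    using s0 by (auto simp: c m_def)
  \<comment> \<open>Either opinion \<open>c\<close> has lost almost half of its initial count, or it
    has become the majority; both are far from \<open>m\<close>, the former because \<epsilon> n is
    at least 4.\<close>
  have A_far: "\<epsilon> * n / 4 \<le> \<bar>real (opinion_count n c s) - m\<bar>" if "?A s" for s
  proof -
    have "real (opinion_count n c s) + real (opinion_count n (\<not> c) s) = n"
      using opinion_count_complement[of n c s] by linarith
    moreover have "real (opinion_count n c s) \<le> \<epsilon> / 2 * n \<or> real (opinion_count n (\<not> c) s) \<le> \<epsilon> / 2 * n"
      using that by (cases c) (auto simp: minority_count_def min_def split: if_splits)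
    moreover have "\<epsilon> * n \<le> 1 / 128 * n"
      using \<epsilon> \<delta> by (intro mult_right_mono) auto
    ultimately show ?thesis
      using mm \<epsilon>(4) by (elim disjE) linarith+
  qed
  have "miss ?A ?B (rtr_step \<beta> n) t s0 \<le> V 0 s0"
  proof (rule miss_le_potential[where I="rtr_inv n" and E="\<lambda>_. False" and r=0 and T=T])
    show "finite (set_pmf (rtr_step \<beta> n s))" if "rtr_inv n s" for s
      using that finite_set_rtr_step by (auto simp: rtr_inv_def)
    show "rtr_inv n s'" if "rtr_inv n s" "s' \<in> set_pmf (rtr_step \<beta> n s)" for s s'
      using that by (rule rtr_inv_step)
    show "0 \<le> V k s" for k s
      using parts[of s k] by (simp add: V_def)
    \<comment> \<open>\<open>F\<close> never falls below 1, so surviving to the deadline contradicts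
      its decay; this is what bounds the survival probability.\<close>
    show "1 \<le> V T s" if "rtr_inv n s" for s
      using parts[of s T] F1[OF that] by (simp add: V_def)
    show "1 \<le> V k s" if "?A s" for k s
      using far[OF A_far[OF that]] fd[of s k] by simp
    fix k s
    assume s: "rtr_inv n s" "k < T" "\<not> ?B s" "V k s < 1"
    have wf: "wf_state n s"
      using s(1) by (simp add: rtr_inv_def)
    note fin = finite_set_rtr_step[OF wf, of \<beta>]
    note step = expectation_rtr_step_le[OF wf s(3) \<beta>(1) n(4), of c]
    \<comment> \<open>Here and for the degrees, \<open>V k s < 1\<close> rules out the bad events
      that would spoil the drift of \<open>F\<close>.\<close>
    have N: "real (opinion_count n c s) \<le> \<delta> / 64 * n"
    proof -
      have "\<bar>real (opinion_count n c s) - m\<bar> < \<epsilon> * n / 4"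
        using far[of s] fd[of s k] s(4) by (force simp: not_le)
      moreover have "\<epsilon> * n \<le> \<delta> / 128 * n"
        using \<epsilon> by (intro mult_right_mono) auto
      ultimately show ?thesis
        using mm by linarith
    qed
    have deg: "deg s v \<le> 41 * n" if v: "v < n" "v \<notin> H" for v
    proof -
      have "exp (- 41 * real n) * 1 * exp (real (deg s v)) \<le> exp (- 41 * real n) * \<rho> ^ (T - k) * g s"
        unfolding g_def using \<rho> v by (intro mult_mono mult_left_mono member_le_sum) auto
      also have "\<dots> < 1"
        using parts[of s k] s(4) by (simp add: V_def)
      also have "exp (- 41 * real n) * 1 * exp (real (deg s v)) = exp (real (deg s v) - 41 * real n)"
        by (simp flip: exp_add)
      finally have "real (deg s v) - 41 * real n < 0"
        by simp
      then show ?thesis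
        by linarith
    qed
    have f: "?E s f \<le> f s + \<beta> / n"
      unfolding f_def by (rule step, rule edge_mean_opinion_sq) (use \<beta> n in auto)
    have g: "?E s g \<le> \<rho> * g s"
      unfolding g_def \<rho>_def by (rule step, rule edge_mean_exp_deg) (use \<beta> n wf in auto)
    have F: "?E s F \<le> (1 - q) * F s"
      unfolding F_def L_def q_def \<delta>_def
      by (rule step, rule edge_mean_exp_lyapunov_le)
        (use \<beta> n wf H deg N in \<open>auto simp: \<delta>_def\<close>)
    have Tk: "T - k = Suc (T - Suc k)"
      using s(2) by simp
    let ?r = "T - Suc k"
    have "?E s (V (Suc k)) = (?E s f + real ?r * (\<beta> / n)) * d + exp (- 41 * real n) * \<rho> ^ ?r * ?E s g
        + (1 - q) ^ ?r * ?E s F"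
      unfolding V_def[abs_def] by (simp add: integrable_measure_pmf_finite[OF fin])
    also have "\<dots> \<le> (f s + \<beta> / n + real ?r * (\<beta> / n)) * d + exp (- 41 * real n) * \<rho> ^ ?r * (\<rho> * g s)
        + (1 - q) ^ ?r * ((1 - q) * F s)"
      using f g F d \<rho> q by (intro add_mono mult_left_mono mult_right_mono) auto
    also have "\<dots> = V k s"
      unfolding V_def Tk by (simp add: algebra_simps add_divide_distrib)
    finally show "?E s (V (Suc k)) \<le> V k s" .
  qed (use s0 t in \<open>auto simp: T_def\<close>)
  also have "V 0 s0 \<le> 128 * \<beta> / (\<epsilon>\<^sup>2 * n) + n * exp (- real n) + exp (- \<beta> * \<delta>\<^sup>2 * n / 1024)"
    unfolding V_def diff_zero
  proof (intro add_mono)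
    show "(f s0 + real T * (\<beta> / n)) * d \<le> 128 * \<beta> / (\<epsilon>\<^sup>2 * n)"
      using n \<epsilon> by (simp add: f_def m_def T_def d_def power2_eq_square field_simps)
    have "\<rho> ^ T \<le> exp (2 / (real n - 1) * T)"
    proof -
      have "0 \<le> 2 / (real n - 1)"
        using n by simp
      then show ?thesis
        unfolding \<rho>_def by (intro one_plus_power_le_exp) linarith
    qed
    also have "\<dots> \<le> exp (32 * real n)"
    proof -
      have "real n * real n \<le> real n * (2 * (real n - 1))"
        using n by (intro mult_left_mono) auto
      then show ?thesis
        using n by (simp add: T_def field_simps power2_eq_square)
    qed
    finally have \<rho>T: "\<rho> ^ T \<le> exp (32 * real n)" .
    have "g s0 \<le> (\<Sum>v\<in>{..<n} - H. exp (8 * real n))"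
      unfolding g_def by (intro sum_mono) (auto simp: H_def not_less simp flip: of_nat_mult intro: of_nat_mono)
    also have "\<dots> \<le> n * exp (8 * real n)"
      using card_mono[of "{..<n}" "{..<n} - H"] by simp
    finally have "exp (- 41 * real n) * \<rho> ^ T * g s0
        \<le> exp (- 41 * real n) * exp (32 * real n) * (n * exp (8 * real n))"
      using \<rho>T g0 zero_le_power[of \<rho> T] \<rho> by (intro mult_mono) auto
    also have "\<dots> = n * exp (- real n)"
      by (simp add: algebra_simps flip: exp_add)
    finally show "exp (- 41 * real n) * \<rho> ^ T * g s0 \<le> n * exp (- real n)" .
    \<comment> \<open>The window length wins here: \<open>q * T\<close> equals 4 \<beta> \<delta>^2
      n / 1024, while the initial exponent is at most 3 \<beta> \<delta>^2 n / 1024, one part from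
      the minority and two from edges between hubs.\<close>
    have "(1 - q) ^ T \<le> exp (- q * T)"
      using one_plus_power_le_exp[of "- q" T] q by simp
    moreover have "F s0 \<le> exp (\<delta> / 64 * (\<beta> * \<delta> * 3 / 16 * n))"
    proof -
      have "L s0 \<le> m + \<beta> * \<delta> / 4 / n * card (dom (fst s0))"
        using L[OF s0(1)] by (simp add: m_def)
      also have "\<dots> \<le> \<beta> * \<delta> / 16 * n + \<beta> * \<delta> / 4 / n * (n * n / 2)"
      proof (intro add_mono mult_left_mono)
        show "m \<le> \<beta> * \<delta> / 16 * n"
          using mm mult_right_mono[OF \<epsilon>(3), of "real n"] by simp
        have "real (2 * card (dom (fst s0))) \<le> real (n * n)"
          using s0(1) unfolding rtr_inv_def of_nat_le_iff by blast
        then show "real (card (dom (fst s0))) \<le> n * n / 2"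
          by simp
      qed (use \<beta> \<delta> n in auto)
      also have "\<dots> = \<beta> * \<delta> * 3 / 16 * n"
        using n by (simp add: field_simps)
      finally show ?thesis
        using \<delta> unfolding F_def by (simp add: mult_left_mono)
    qed
    ultimately have "(1 - q) ^ T * F s0 \<le> exp (- q * T) * exp (\<delta> / 64 * (\<beta> * \<delta> * 3 / 16 * n))"
      by (intro mult_mono) (auto simp: F_def)
    also have "\<dots> = exp (- q * T + \<delta> / 64 * (\<beta> * \<delta> * 3 / 16 * n))"
      by (rule exp_add[symmetric])
    also have "- q * T + \<delta> / 64 * (\<beta> * \<delta> * 3 / 16 * n) = - \<beta> * \<delta>\<^sup>2 * n / 1024"
      using n by (simp add: q_def T_def power2_eq_square field_simps)
    finally show "(1 - q) ^ T * F s0 \<le> exp (- \<beta> * \<delta>\<^sup>2 * n / 1024)" .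
  qed
  finally show ?thesis .
qed

section \<open>Descent to a small minority\<close>

lemma edge_mean_opinion_product:
  fixes \<beta> :: real
  assumes \<beta>: "0 < \<beta>" "\<beta> < n" and ab: "a < n" "b < n" "snd s a = c" "snd s b = (\<not> c)"
  shows "edge_mean \<beta> n (\<lambda>s. real (opinion_count n c s) * (n - real (opinion_count n c s))) s e a b
    \<le> real (opinion_count n c s) * (n - real (opinion_count n c s)) - \<beta> / n"
proof -
  obtain pl op where s: "s = (pl, op)" by (cases s)
  let ?F = "\<lambda>s. real (opinion_count n c s) * (n - real (opinion_count n c s))"
  let ?x = "real (opinion_count n c s)"
  have leave: "real (opinion_count n c (pl, op(a := op b))) = ?x - 1"
    using opinion_count_leave[of a n op c pl] ab by (simp only: s snd_conv)
  have join: "real (opinion_count n c (pl, op(b := op a))) = ?x + 1"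
    using opinion_count_join[of b n op c pl] ab by (simp only: s snd_conv)
  have stay: "opinion_count n c (pl', op) = opinion_count n c s" for pl'
    by (simp add: s opinion_count_def)
  have "edge_mean \<beta> n ?F (pl, op) e a b
      \<le> \<beta> / n * (((?x - 1) * (n - (?x - 1)) + (?x + 1) * (n - (?x + 1))) / 2)
        + (1 - \<beta> / n) * ((?x * (n - ?x) + ?x * (n - ?x)) / 2 + (\<Sum>w<n. 0) / (real n - 1))"
  proof (rule edge_mean_le[OF \<beta> ab(1,2)])
    show "a \<noteq> b" using ab by auto
  qed (simp_all add: leave join stay)
  also have "k * (((x - 1) * (n - (x - 1)) + (x + 1) * (n - (x + 1))) / 2)
      + (1 - k) * ((x * (n - x) + x * (n - x)) / 2 + (\<Sum>w<n. 0) / (real n - 1)) = x * (n - x) - k"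
    for k x :: real
    by (simp add: field_simps)
  finally show ?thesis
    by (simp add: s)
qed

text \<open>
  From a larger minority, the small-minority regime or termination is reached in time
  because the product of the two opinion counts has drift \<open>- \<beta> / n\<close>.
\<close>

lemma miss_from_above:
  fixes \<beta> \<epsilon> \<eta> :: real
  assumes \<beta>: "0 < \<beta>" "\<beta> < n" and \<epsilon>: "2 \<le> \<epsilon> * n" and \<eta>: "0 \<le> \<eta>" and T: "0 < T"
    and small: "\<And>s t. rtr_inv n s \<Longrightarrow> \<epsilon> * n - 1 < minority_count n s \<Longrightarrow> minority_count n s \<le> \<epsilon> * n \<Longrightarrow>
      r \<le> t \<Longrightarrow> miss (\<lambda>s. real (minority_count n s) \<le> \<epsilon> / 2 * n) (\<lambda>s. disagreeing s = {})
        (rtr_step \<beta> n) t s \<le> \<eta>"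
    and s: "rtr_inv n s" "\<epsilon> * n < minority_count n s"
  shows "miss (\<lambda>s. real (minority_count n s) \<le> \<epsilon> / 2 * n) (\<lambda>s. disagreeing s = {}) (rtr_step \<beta> n) (r + T) s
    \<le> \<eta> + real n ^ 3 / (\<beta> * T)"
proof -
  let ?A = "\<lambda>s. real (minority_count n s) \<le> \<epsilon> / 2 * n"
  let ?B = "\<lambda>s. disagreeing s = {}"
  \<comment> \<open>The minority changes by at most one per step, so it cannot jump over the unit
    interval below \<epsilon> n in which \<open>small\<close> applies.\<close>
  let ?I = "\<lambda>s. rtr_inv n s \<and> \<epsilon> * n - 1 < minority_count n s"
  define Q where "Q s = real (opinion_count n True s) * (n - real (opinion_count n True s))" for s
  \<comment> \<open>The clock term compensates the drift of \<open>Q\<close> and alone reaches 1 at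
    time \<open>T\<close>.\<close>
  define V where "V k s = \<eta> + (Q s + \<beta> / n * k) * (n / (\<beta> * T))" for k :: nat and s
  have le_n: "opinion_count n c s \<le> n" for c s
    using opinion_count_complement[of n c s] by linarith
  have Q: "0 \<le> Q s" "Q s \<le> n * n" for s
    using le_n[of True s] by (auto simp: Q_def intro!: mult_mono)
  have n: "0 < real n"
    using \<beta> by simp
  have x: "0 < n / (\<beta> * T)" "0 < \<beta> / n"
    using \<beta> T n by auto
  have V\<eta>: "\<eta> \<le> V k s" for k s
  proof -
    have "0 \<le> (Q s + \<beta> / n * k) * (n / (\<beta> * T))"
      using x Q[of s] by (intro mult_nonneg_nonneg add_nonneg_nonneg) auto
    then show ?thesis
      by (simp add: V_def)
  qed
  have "miss ?A ?B (rtr_step \<beta> n) (r + T) s \<le> V 0 s"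
  proof (rule miss_le_potential[where I="?I" and E="\<lambda>s. minority_count n s \<le> \<epsilon> * n" and r=r and T=T])
    show "finite (set_pmf (rtr_step \<beta> n s))" if "?I s" for s
      using that finite_set_rtr_step by (auto simp: rtr_inv_def)
    show "0 \<le> V k s" for k s
      using V\<eta>[of k s] \<eta> by simp
    show "1 \<le> V T s" for s
    proof -
      have "\<beta> / n * T * (n / (\<beta> * T)) \<le> (Q s + \<beta> / n * T) * (n / (\<beta> * T))"
        using Q[of s] x by (intro mult_right_mono) auto
      moreover have "\<beta> / n * T * (n / (\<beta> * T)) = 1"
        using \<beta> n T by simp
      ultimately show ?thesis
        using \<eta> by (simp add: V_def)
    qed
    show "1 \<le> V k s" if "?I s" "?A s" for k s
      using that \<epsilon> by linarith
    show "miss ?A ?B (rtr_step \<beta> n) t s \<le> V k s" if "?I s" "minority_count n s \<le> \<epsilon> * n" "r \<le> t" for k t s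
      using small[of s t] that V\<eta>[of k s] by linarith
    show "?I s'" if "?I s" "\<not> minority_count n s \<le> \<epsilon> * n" "s' \<in> set_pmf (rtr_step \<beta> n s)" for s s'
    proof -
      have "wf_state n s"
        using that(1) by (simp add: rtr_inv_def)
      then have "real (minority_count n s) - 1 \<le> minority_count n s'"
        using rtr_step_cases[OF _ that(3), of True] rtr_step_cases[OF _ that(3), of False]
        by (auto simp: minority_count_def min_def abs_le_iff)
      then show ?thesis
        using that rtr_inv_step by auto
    qed
    fix k s
    assume s: "?I s" "\<not> ?B s"
    then have wf: "wf_state n s"
      by (simp add: rtr_inv_def)
    note fin = finite_set_rtr_step[OF wf, of \<beta>]
    let ?E = "measure_pmf.expectation (rtr_step \<beta> n s)"
    have "?E Q \<le> Q s - \<beta> / n"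
      unfolding Q_def
      by (rule expectation_rtr_step_le[OF wf s(2) \<beta>, of True], rule edge_mean_opinion_product)
        (use \<beta> in auto)
    then have "\<eta> + (?E Q + \<beta> / n * Suc k) * (n / (\<beta> * T))
        \<le> \<eta> + (Q s - \<beta> / n + \<beta> / n * Suc k) * (n / (\<beta> * T))"
      using x by (intro add_mono mult_right_mono) auto
    also have "Q s - \<beta> / n + \<beta> / n * Suc k = Q s + \<beta> / n * k"
      using n by (simp add: field_simps)
    also have "\<eta> + \<dots> * (n / (\<beta> * T)) = V k s"
      by (simp add: V_def)
    finally show "?E (V (Suc k)) \<le> V k s"
      unfolding V_def[abs_def] by (simp add: integrable_measure_pmf_finite[OF fin])
  qed (use s in auto)
  also have "V 0 s = \<eta> + Q s * (n / (\<beta> * T))"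
    by (simp add: V_def)
  also have "\<dots> \<le> \<eta> + n * n * (n / (\<beta> * T))"
    using Q[of s] x by (intro add_left_mono mult_right_mono) auto
  also have "\<dots> = \<eta> + real n ^ 3 / (\<beta> * T)"
    by (simp add: power3_eq_cube)
  finally show ?thesis .
qed

text \<open>Initially the opinion count is binomial, and Hoeffding's inequality applies to a
  deviation of n / 4.\<close>

lemma prob_init_small_minority:
  fixes \<epsilon> :: real
  assumes n: "0 < n" and \<epsilon>: "\<epsilon> \<le> 1 / 4"
  shows "measure_pmf.prob (rtr_init n) {s. \<not> \<epsilon> * n < minority_count n s} \<le> 2 * exp (- real n / 8)"
proof -
  interpret binomial_distribution n "1 / 2"
    by unfold_locales auto
  have map: "map_pmf (opinion_count n True) (rtr_init n) = binomial_pmf n (1 / 2)"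
    by (subst binomial_pmf_altdef'[where A="{..<n}" and dflt=False])
       (auto simp: rtr_init_def map_bind_pmf opinion_count_def map_pmf_def bind_assoc_pmf bind_return_pmf)
  have "measure_pmf.prob (rtr_init n) {s. \<not> \<epsilon> * n < minority_count n s}
      \<le> measure_pmf.prob (rtr_init n) (opinion_count n True -` {x. \<bar>real x - n * (1 / 2)\<bar> \<ge> n / 4})"
  proof (intro measure_pmf.finite_measure_mono subsetI vimageI2 CollectI)
    fix s assume "s \<in> {s. \<not> \<epsilon> * n < minority_count n s}"
    then have "real (minority_count n s) \<le> \<epsilon> * n"
      by simp
    moreover have "\<epsilon> * n \<le> 1 / 4 * n"
      using \<epsilon> by (intro mult_right_mono) auto
    moreover have "real (opinion_count n True s) + real (opinion_count n False s) = n"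
      using opinion_count_complement[of n True s] by simp
    moreover have "minority_count n s = opinion_count n True s \<or> minority_count n s = opinion_count n False s"
      by (auto simp: minority_count_def)
    ultimately show "\<bar>real (opinion_count n True s) - n * (1 / 2)\<bar> \<ge> n / 4"
      by (elim disjE) linarith+
  qed auto
  also have "\<dots> = measure_pmf.prob (binomial_pmf n (1 / 2)) {x. \<bar>real x - n * (1 / 2)\<bar> \<ge> n / 4}"
    by (simp flip: map add: measure_map_pmf)
  also have "\<dots> \<le> 2 * exp (-2 * (n / 4)\<^sup>2 / n)"
    by (rule prob_abs_ge) (use n in auto)
  also have "-2 * (real n / 4)\<^sup>2 / n = - real n / 8"
    using n by (simp add: power2_eq_square)
  finally show ?thesis .
qed

section \<open>Conclusion for the path measure\<close>

lemma finite_set_Pi_pmf: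
  assumes "finite A" "\<And>x. x \<in> A \<Longrightarrow> finite (set_pmf (p x))"
  shows "finite (set_pmf (Pi_pmf A dflt p))"
  by (rule finite_subset[OF set_Pi_pmf_subset'[OF assms(1)]]) (use assms in \<open>auto intro: finite_PiE_dflt\<close>)

lemma finite_set_rtr_init: "finite (set_pmf (rtr_init n))"
  by (auto simp: rtr_init_def erdos_renyi_def finite_set_Pi_pmf)

lemma hitting_time_less:
  assumes "B (\<omega> j)" "\<And>i. i \<le> j \<Longrightarrow> \<not> A (\<omega> i)"
  shows "hitting_time B \<omega> < hitting_time A \<omega>"
proof -
  have "hitting_time B \<omega> \<le> enat j"
    using assms(1) unfolding hitting_time_def by (intro INF_lower2[of j]) auto
  also have "enat j < enat (Suc j)"
    by simp
  also have "enat (Suc j) \<le> hitting_time A \<omega>"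
    using assms(2) unfolding hitting_time_def by (intro INF_greatest) (auto simp: not_le Suc_le_eq intro: ccontr)
  finally show ?thesis .
qed

theorem theorem2:
  fixes \<beta> :: real
  assumes "\<beta> > 0"
  shows "\<exists>\<epsilon>>0. (\<lambda>n. \<P>(\<omega> in rtr_chain \<beta> n. tau \<omega> < tau_star n \<epsilon> \<omega>)) \<longlonglongrightarrow> 1"
proof -
  define \<delta> where "\<delta> = exp (- 82 * \<beta>)"
  \<comment> \<open>The first bound keeps the minority below \<delta> n / 64 throughout the window,
    the second limits its initial share of the Lyapunov function.\<close>
  define \<epsilon> where "\<epsilon> = min (\<delta> / 128) (\<beta> * \<delta> / 16)"
  have \<delta>: "0 < \<delta>" "\<delta> \<le> 1"
    using assms by (auto simp: \<delta>_def)
  have \<epsilon>: "0 < \<epsilon>" "\<epsilon> \<le> \<delta> / 128" "\<epsilon> \<le> \<beta> * \<delta> / 16"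
    using assms \<delta> by (auto simp: \<epsilon>_def)
  define \<eta> where "\<eta> n = 128 * \<beta> / (\<epsilon>\<^sup>2 * n) + n * exp (- real n) + exp (- \<beta> * \<delta>\<^sup>2 * n / 1024)" for n :: nat
  define err where "err n = 2 * exp (- real n / 8) + (\<eta> n + real n ^ 3 / (\<beta> * real (n ^ 4)))" for n :: nat
  \<comment> \<open>The threshold is \<epsilon>/2 because the final window opens at a minority of
    about \<epsilon> n and needs room for fluctuations.\<close>
  let ?P = "\<lambda>n. \<P>(\<omega> in rtr_chain \<beta> n. tau \<omega> < tau_star n (\<epsilon> / 2) \<omega>)"
  have "err \<longlonglongrightarrow> 0"
  proof -
    have lim: "(\<lambda>n::nat. 2 * exp (- real n / 8) + (a / n + n * exp (- real n) + exp (- b * real n)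
        + real n ^ 3 / (\<beta> * real (n ^ 4)))) \<longlonglongrightarrow> 0" if "0 < b" for a b :: real
      using assms that by real_asymp
    have "0 < \<beta> * \<delta>\<^sup>2 / 1024"
      using assms \<delta> by auto
    from lim[OF this, of "128 * \<beta> / \<epsilon>\<^sup>2"] show ?thesis
      by (simp add: err_def[abs_def] \<eta>_def)
  qed
  then have lim: "(\<lambda>n. 1 - err n) \<longlonglongrightarrow> 1"
    by (auto intro!: tendsto_eq_intros)
  have "eventually (\<lambda>n. 1 - err n \<le> ?P n) sequentially"
  proof -
    obtain n0 :: nat where n0: "9 * \<beta> + 2 + 4 / \<epsilon> \<le> n0"
      using real_arch_simple by blast
    have "1 - err n \<le> ?P n" if "n0 \<le> n" for n
    proof -
      have "9 * \<beta> + 2 + 4 / \<epsilon> \<le> n"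
        using n0 that by linarith
      moreover have "0 < 4 / \<epsilon>"
        using \<epsilon> by simp
      ultimately have n: "9 * \<beta> \<le> n" "2 \<le> n" "4 / \<epsilon> \<le> n" "0 < n" "\<beta> < n"
        using assms by linarith+
      then have \<epsilon>n: "4 \<le> \<epsilon> * n"
        using \<epsilon> by (simp add: field_simps)
      have "1 - measure_pmf.prob (rtr_init n) {s. \<not> \<epsilon> * n < minority_count n s}
          - (\<eta> n + real n ^ 3 / (\<beta> * real (n ^ 4))) \<le> ?P n"
        unfolding rtr_chain_def
      \<comment> \<open>The n^4 steps for the descent cost an error of 1 / (\<beta> n); the other 8
        n^2 steps are the final window.\<close>
      proof (rule prob_success_ge[where I="rtr_inv n" and A="\<lambda>s. real (minority_count n s) \<le> \<epsilon> / 2 * n"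
            and B="\<lambda>s. disagreeing s = {}" and t="8 * n\<^sup>2 + n ^ 4"])
        show "finite (set_pmf (rtr_step \<beta> n s))" if "rtr_inv n s" for s
          using that finite_set_rtr_step by (auto simp: rtr_inv_def)
        show "{\<omega> \<in> space (mc_path (rtr_init n) (rtr_step \<beta> n)). tau \<omega> < tau_star n (\<epsilon> / 2) \<omega>}
            \<in> sets (mc_path (rtr_init n) (rtr_step \<beta> n))"
          using sets_tau_less_tau_star[of \<beta> n "\<epsilon> / 2"] by (simp add: rtr_chain_def)
        show "\<omega> \<in> {\<omega> \<in> space (mc_path (rtr_init n) (rtr_step \<beta> n)). tau \<omega> < tau_star n (\<epsilon> / 2) \<omega>}"
          if "disagreeing (\<omega> j) = {}" "\<And>i. i \<le> j \<Longrightarrow> \<not> real (minority_count n (\<omega> i)) \<le> \<epsilon> / 2 * n" for \<omega> j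
          using hitting_time_less[of "\<lambda>s. disagreeing s = {}" \<omega> j, OF that(1)] that(2)
          by (simp add: tau_def tau_star_def)
        have \<eta>: "0 \<le> \<eta> n"
          using assms by (simp add: \<eta>_def)
        then show "0 \<le> \<eta> n + real n ^ 3 / (\<beta> * real (n ^ 4))"
          using assms by simp
        show "miss (\<lambda>s. real (minority_count n s) \<le> \<epsilon> / 2 * n) (\<lambda>s. disagreeing s = {}) (rtr_step \<beta> n)
            (8 * n\<^sup>2 + n ^ 4) s \<le> \<eta> n + real n ^ 3 / (\<beta> * real (n ^ 4))"
          if "s \<in> set_pmf (rtr_init n)" "\<epsilon> * n < minority_count n s" for s
        proof (rule miss_from_above[OF assms n(5) _ \<eta>])
          show "miss (\<lambda>s. real (minority_count n s) \<le> \<epsilon> / 2 * n) (\<lambda>s. disagreeing s = {}) (rtr_step \<beta> n) t s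
              \<le> \<eta> n"
            if "rtr_inv n s" "\<epsilon> * n - 1 < minority_count n s" "minority_count n s \<le> \<epsilon> * n" "8 * n\<^sup>2 \<le> t" for s t
            unfolding \<eta>_def \<delta>_def
            by (rule miss_small_minority) (use assms n \<epsilon> \<epsilon>n that in \<open>auto simp: \<delta>_def\<close>)
        qed (use that rtr_inv_init \<epsilon>n n in auto)
      qed (use finite_set_rtr_init rtr_inv_init rtr_inv_step in auto)
      moreover have "measure_pmf.prob (rtr_init n) {s. \<not> \<epsilon> * n < minority_count n s} \<le> 2 * exp (- real n / 8)"
        using \<epsilon> \<delta> n by (intro prob_init_small_minority) auto
      ultimately show ?thesis
        by (simp add: err_def)
    qed
    then show ?thesis
      by (auto simp: eventually_sequentially)
  qed
  moreover have "?P n \<le> 1" for n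
    using prob_space.prob_le_1[OF prob_space_mc_path] by (simp add: rtr_chain_def)
  ultimately have "?P \<longlonglongrightarrow> 1"
    using lim by (intro tendsto_sandwich[OF _ _ lim tendsto_const]) auto
  then show ?thesis
    using \<epsilon> by (intro exI[of _ "\<epsilon> / 2"]) auto
qed

end
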